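(* Let $R>0$ and let $S\subset\mathbb{R}^2$ be a compact set whose volume function satisfies $$V(r;S)=\mu(S)+L_0 r+\pi r^2,\qquad 0\le r<R.$$ Let $D_1,\dots,D_n$ be an i.i.d. sample of the distance variable $D=\mathcal{D}(X,S)$, where $X$ is uniformly distributed on $B(S,R)\setminus S$. Then the maximum likelihood estimator $\widehat L_0$ of $L_0$ appears as the solution of the likelihood equation $$\frac1n\sum_{i=1}^n\left(\frac{1}{\widehat L_0+2\pi D_i}\right)=\frac{1}{\widehat L_0+\pi R}.$$ This estimator is asymptotically normal, that is, $$\sqrt n\,(\widehat L_0-L_0)\longrightarrow N\big(0,\sigma^2_{\widehat L_0}\big)\quad\text{in law as } n\to\infty,$$ where $$\sigma^2_{\widehat L_0}=(L_0+\pi R)\left[\frac{1}{2\pi R}\log\left(1+\frac{2\pi R}{L_0}\right)-\frac{1}{L_0+\pi R}\right]^{-1}$$ coincides with the Fréchet–Cramér–Rao bound (given by the inverse of Fisher's information measure).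
   Context: For $x\in\mathbb{R}^2$, $\mathcal{D}(x,S)=\inf_{y\in S}\|x-y\|$ is the Euclidean distance to $S$; $B(S,r)=\{x:\mathcal{D}(x,S)\le r\}$ is the closed $r$-parallel set; $\mu$ is Lebesgue measure on $\mathbb{R}^2$; $V(r;S)=\mu(B(S,r))$ is the volume function of $S$. The coefficient $L_0$ is the unknown parameter to be estimated (the boundary measure of $S$), and $R$ is a fixed constant. Under the assumption on $V$, the variable $D$ has density $f(r;L_0)=\frac{L_0+2\pi r}{L_0R+\pi R^2}$ for $0\le r<R$, so the log-likelihood of the sample is $\ell(L_0;D_1,\dots,D_n)=-n\log(L_0R+\pi R^2)+\sum_{i=1}^n\log(L_0+2\pi D_i)$. Fisher's information measure is $I(L_0)=\mathbb{E}_{L_0}\big[(\tfrac{\partial}{\partial L_0}\log f(D;L_0))^2\big]$. *)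

theory Defs
  imports "HOL-Probability.Probability"
begin

definition parallel_set :: "(real^2) set \<Rightarrow> real \<Rightarrow> (real^2) set" where
  "parallel_set S r = {x. infdist x S \<le> r}"

definition volume_fun :: "(real^2) set \<Rightarrow> real \<Rightarrow> real" where
  "volume_fun S r = measure lborel (parallel_set S r)"

definition dist_density :: "real \<Rightarrow> real \<Rightarrow> real \<Rightarrow> real" where
  "dist_density R L r =
     (if 0 \<le> r \<and> r < R then (L + 2 * pi * r) / (L * R + pi * R\<^sup>2) else 0)"

text \<open>The sample is \<open>d 0, \<dots>, d (n - 1)\<close>.\<close>

definition loglik :: "real \<Rightarrow> nat \<Rightarrow> (nat \<Rightarrow> real) \<Rightarrow> real \<Rightarrow> real" where
  "loglik R n d L =
     - real n * ln (L * R + pi * R\<^sup>2) + (\<Sum>i<n. ln (L + 2 * pi * d i))"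

lemma loglik_eq_sum_ln_density:
  assumes "R > 0" "L > 0" "\<And>i. i < n \<Longrightarrow> 0 \<le> d i \<and> d i < R"
  shows "loglik R n d L = (\<Sum>i<n. ln (dist_density R L (d i)))"
proof -
  have "0 < L * R + pi * R\<^sup>2"
    using assms by (simp add: add_pos_pos)
  moreover have "L + 2 * pi * d i \<noteq> 0" if "i < n" for i
    using assms that by (metis add_pos_nonneg mult_nonneg_nonneg pi_ge_zero zero_le_numeral less_irrefl)
  ultimately have "(\<Sum>i<n. ln (dist_density R L (d i))) =
      (\<Sum>i<n. ln (L + 2 * pi * d i) - ln (L * R + pi * R\<^sup>2))"
    using assms by (intro sum.cong refl) (simp add: dist_density_def ln_div)
  then show ?thesis
    by (simp add: loglik_def sum_subtractf)
qed

text \<open>The parameter space is the open half-line \<open>L > 0\<close>.\<close>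

definition is_mle :: "real \<Rightarrow> nat \<Rightarrow> (nat \<Rightarrow> real) \<Rightarrow> real \<Rightarrow> bool" where
  "is_mle R n d L \<longleftrightarrow> is_arg_max (loglik R n d) (\<lambda>L. L > 0) L"

text \<open>For some samples the likelihood has no maximum on \<open>L > 0\<close> (it may be monotone in
  \<open>L\<close>, for instance when \<open>n = 1\<close>). A maximum likelihood estimator is therefore a random variable
  that is a maximiser whenever one exists; its value on other samples is unconstrained.\<close>

definition ml_estimator ::
    "'a measure \<Rightarrow> real \<Rightarrow> nat \<Rightarrow> (nat \<Rightarrow> 'a \<Rightarrow> real) \<Rightarrow> ('a \<Rightarrow> real) \<Rightarrow> bool" where
  "ml_estimator M R n D Lhat \<longleftrightarrow>
     Lhat \<in> borel_measurable M \<and>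
     (\<forall>\<omega>\<in>space M. (\<exists>L. is_mle R n (\<lambda>i. D i \<omega>) L) \<longrightarrow> is_mle R n (\<lambda>i. D i \<omega>) (Lhat \<omega>))"

text \<open>Fisher information at \<open>\<theta>\<close> of a family of densities \<open>f \<theta>\<close> on the real line.\<close>

definition fisher_information :: "(real \<Rightarrow> real \<Rightarrow> real) \<Rightarrow> real \<Rightarrow> real" where
  "fisher_information f \<theta> =
     (\<integral>r. (deriv (\<lambda>t. ln (f t r)) \<theta>)\<^sup>2 \<partial>density lborel (\<lambda>r. ennreal (f \<theta> r)))"

definition asymp_var :: "real \<Rightarrow> real \<Rightarrow> real" where
  "asymp_var R L =
     (L + pi * R) *
     inverse (1 / (2 * pi * R) * ln (1 + 2 * pi * R / L) - 1 / (L + pi * R))"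

end

theory Submission
  imports Defs
begin

text \<open>
  The level set of the distance function at height \<open>R\<close> is negligible, so the volume formula
  extends to \<open>r = R\<close> and gives the distribution function of \<open>D\<close>. The likelihood equation is
  also sufficient for a maximum: if \<open>t\<close> solves it, applying \<open>ln x \<le> x - 1\<close> to each likelihood
  ratio bounds \<open>l(L) - l(t)\<close> by a multiple of the score at \<open>t\<close>, which is \<open>0\<close>.

  Multiplied by \<open>(t + \<pi> R)\<^sup>2\<close>, the derivative of the log-likelihood is decreasing in \<open>t\<close>. It changes
  sign between \<open>L\<^sub>0 / 2\<close> and \<open>2 L\<^sub>0\<close> with probability tending to \<open>1\<close>, and on that event the
  estimator is at most \<open>t\<close> iff this function is \<open>\<le> 0\<close> at \<open>t\<close>. At \<open>t = L\<^sub>0 + x / \<surd>n\<close> this compares a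
  normalised sum of scores, to which the central limit theorem applies, with a quantity that
  converges in probability to a constant; no consistency argument is needed.
\<close>

section \<open>The distance distribution\<close>

text \<open>Seen from the centre of a ball of radius less than \<open>R / 2\<close> that contains \<open>K\<close>, the
  distance to every point of \<open>K\<close> increases along rays once it can reach \<open>R\<close>, so each ray meets the
  level set at most once.\<close>

lemma negligible_infdist_sphere_local:
  fixes K :: "'a::euclidean_space set"
  assumes "compact K" "K \<noteq> {}" "K \<subseteq> cball a \<delta>" "2 * \<delta> < R"
  shows "negligible {x. infdist x K = R}"
proof (rule starlike_negligible_strong[where a = a])
  show "closed {x. infdist x K = R}"
    by (intro closed_Collect_eq continuous_intros)
next
  fix c :: real and x
  assume c: "0 \<le> c" "c < 1" and x: "a + x \<in> {x. infdist x K = R}"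
  show "a + c *\<^sub>R x \<notin> {x. infdist x K = R}"
  proof
    assume cx: "a + c *\<^sub>R x \<in> {x. infdist x K = R}"
    obtain y where y: "y \<in> K" "infdist (a + x) K = dist (a + x) y"
      using infdist_attains_inf[OF compact_imp_closed[OF assms(1)] assms(2)] by blast
    define z where "z = y - a"
    have z: "norm z \<le> \<delta>"
      using y(1) assms(3) by (auto simp: z_def dist_norm norm_minus_commute)
    have dist: "dist (a + s *\<^sub>R x) y = norm (s *\<^sub>R x - z)" for s
      by (simp add: dist_norm z_def algebra_simps)
    have R: "R = norm (x - z)"
      using x y dist[of 1] by simp
    have R_le: "R \<le> norm (c *\<^sub>R x - z)"
      using cx infdist_le[OF y(1), of "a + c *\<^sub>R x"] dist[of c] by simp
    \<comment> \<open>Here \<open>2 * \<delta> < R\<close> enters: the point \<open>c x\<close> is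
      at least \<open>R\<close> away from \<open>z\<close>, which has norm at most
      \<open>\<delta>\<close>, so \<open>c x\<close> lies farther than \<open>\<delta>\<close> from
      the centre.\<close>
    have "norm (c *\<^sub>R x - z) \<le> c * norm x + norm z"
      using norm_triangle_ineq4[of "c *\<^sub>R x" z] c by simp
    then have cn: "\<delta> < c * norm x"
      using R_le z assms(4) by linarith
    have n: "c * norm x \<le> norm x"
      using c by (simp add: mult_left_le_one_le)
    have n_pos: "0 < norm x"
      using cn z norm_ge_zero[of z] n by linarith
    have "x \<bullet> z \<le> norm x * norm z"
      by (rule norm_cauchy_schwarz)
    also have "\<dots> \<le> norm x * \<delta>"
      using z by (intro mult_left_mono) auto
    finally have "2 * (x \<bullet> z) \<le> norm x * (2 * \<delta>)"
      by simp
    moreover have "2 * \<delta> < (1 + c) * norm x"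
      using cn n by (simp add: distrib_right)
    then have "norm x * (2 * \<delta>) < norm x * ((1 + c) * norm x)"
      using n_pos by (intro mult_strict_left_mono)
    ultimately have "2 * (x \<bullet> z) < norm x * ((1 + c) * norm x)"
      by linarith
    \<comment> \<open>The difference of the two squared distances to \<open>z\<close> is a quadratic
      polynomial in \<open>c\<close> with the root \<open>c = 1\<close>; the cofactor is positive by
      the bound just obtained. Hence moving outward from \<open>c x\<close> to \<open>x\<close>
      strictly increases the distance to \<open>y\<close>.\<close>
    then have "0 < (1 - c) * ((1 + c) * (norm x)\<^sup>2 - 2 * (x \<bullet> z))"
      using c by (intro mult_pos_pos) (auto simp: power2_eq_square algebra_simps)
    also have "\<dots> = (norm (x - z))\<^sup>2 - (norm (c *\<^sub>R x - z))\<^sup>2"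
      unfolding power2_norm_eq_inner
      by (simp add: inner_diff_left inner_diff_right inner_commute algebra_simps)
    finally have "norm (c *\<^sub>R x - z) < norm (x - z)"
      by (simp add: power2_less_imp_less)
    then show False
      using R R_le by simp
  qed
qed

text \<open>By compactness \<open>S\<close> is a finite union of pieces of radius
  \<open>R / 3\<close>. A nearest point of \<open>S\<close> lies in one of them, so the level set is
  covered by the level sets of the pieces, each of which is small enough for the local
  version.\<close>

lemma negligible_infdist_sphere:
  fixes S :: "'a::euclidean_space set"
  assumes S: "compact S" and R: "0 < R"
  shows "negligible {x. infdist x S = R}"
proof -
  obtain T where T: "T \<subseteq> S" "finite T" "S \<subseteq> (\<Union>a\<in>T. ball a (R / 3))"
  proof (rule compactE_image[OF S, of S "\<lambda>a. ball a (R / 3)"])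
    show "S \<subseteq> (\<Union>a\<in>S. ball a (R / 3))"
      using R by (auto intro: centre_in_ball[THEN iffD2])
  qed auto
  let ?K = "\<lambda>a. S \<inter> cball a (R / 3)"
  have "{x. infdist x S = R} \<subseteq> (\<Union>a\<in>T. {x. infdist x (?K a) = R})"
  proof
    fix x assume "x \<in> {x. infdist x S = R}"
    then have x: "infdist x S = R" by simp
    then have "S \<noteq> {}" using R by (auto simp: infdist_def)
    then obtain y where y: "y \<in> S" "infdist x S = dist x y"
      using infdist_attains_inf[OF compact_imp_closed[OF S]] by blast
    then obtain a where a: "a \<in> T" "y \<in> ball a (R / 3)"
      using T by blast
    then have yK: "y \<in> ?K a" using y by auto
    have "infdist x (?K a) \<le> R"
      using infdist_le[OF yK, of x] y x by simp
    moreover have "R \<le> infdist x (?K a)"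
      using infdist_mono[OF Int_lower1, of S "cball a (R / 3)" x] yK x by blast
    ultimately show "x \<in> (\<Union>a\<in>T. {x. infdist x (?K a) = R})"
      using a by auto
  qed
  moreover have "negligible (\<Union>a\<in>T. {x. infdist x (?K a) = R})"
  proof (rule negligible_Union)
    show "finite ((\<lambda>a. {x. infdist x (?K a) = R}) ` T)" using T by simp
    fix E assume "E \<in> (\<lambda>a. {x. infdist x (?K a) = R}) ` T"
    then obtain a where a: "a \<in> T" "E = {x. infdist x (?K a) = R}" by auto
    have "a \<in> ?K a" using a T R by auto
    then show "negligible E"
      unfolding a(2) using S R
      by (intro negligible_infdist_sphere_local[where \<delta> = "R / 3" and a = a])
         (auto intro: compact_Int_closed)
  qed
  ultimately show ?thesis
    using negligible_subset by blast
qed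

section \<open>Volumes of parallel sets up to and including radius \<open>R\<close>\<close>

text \<open>Nonemptiness matters: \<open>infdist x {} = 0\<close>, so for \<open>0 <= r\<close> the
  parallel set of the empty set is the whole plane.\<close>

lemma compact_parallel_set:
  assumes "compact S" "S \<noteq> {}"
  shows "compact (parallel_set S r)"
proof -
  obtain b where b: "\<And>y. y \<in> S \<Longrightarrow> norm y \<le> b"
    using compact_imp_bounded[OF assms(1)] by (auto simp: bounded_iff)
  have "norm x \<le> b + r" if "x \<in> parallel_set S r" for x
  proof -
    obtain y where "y \<in> S" "infdist x S = dist x y"
      using infdist_attains_inf[OF compact_imp_closed[OF assms(1)] assms(2)] by blast
    then show ?thesis
      using that b[of y] norm_triangle_sub[of x y] by (simp add: parallel_set_def dist_norm)
  qed
  then have "bounded (parallel_set S r)"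
    by (auto simp: bounded_iff)
  moreover have "closed (parallel_set S r)"
    unfolding parallel_set_def by (intro closed_Collect_le continuous_intros)
  ultimately show ?thesis
    by (simp add: compact_eq_bounded_closed)
qed

lemma parallel_set_mono: "r \<le> s \<Longrightarrow> parallel_set S r \<subseteq> parallel_set S s"
  by (auto simp: parallel_set_def)

lemma subset_parallel_set: "0 \<le> r \<Longrightarrow> S \<subseteq> parallel_set S r"
  by (auto simp: parallel_set_def)

text \<open>Parallel sets with radii increasing to \<open>R\<close> exhaust only the open set
  \<open>infdist x S < R\<close>. Continuity from below gives the measure of that set, and the
  missing level set is null.\<close>

lemma volume_fun_tendsto:
  assumes "compact S" "S \<noteq> {}" "0 < R"
  shows "(\<lambda>n. volume_fun S (R * (1 - 1 / real (Suc n)))) \<longlonglongrightarrow> volume_fun S R"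
proof -
  let ?r = "\<lambda>n. R * (1 - 1 / real (Suc n))"
  have [measurable, simp]: "parallel_set S r \<in> sets borel" for r
    using compact_parallel_set[OF assms(1,2)] by (simp add: borel_compact)
  have fin: "emeasure lborel (parallel_set S r) \<noteq> \<infinity>" for r
    using emeasure_compact_finite[OF compact_parallel_set[OF assms(1,2)], of r] by simp
  have r_mono: "?r m \<le> ?r n" if "m \<le> n" for m n
    using that \<open>0 < R\<close> by (intro mult_left_mono diff_left_mono divide_left_mono) auto
  have r_less: "?r n < R" for n
    using \<open>0 < R\<close> by (simp add: mult_less_cancel_left2)
  have U: "(\<Union>n. parallel_set S (?r n)) = {x. infdist x S < R}"
  proof safe
    fix x n assume "x \<in> parallel_set S (?r n)"
    then show "infdist x S < R"
      using r_less[of n] unfolding parallel_set_def mem_Collect_eq by linarith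
  next
    fix x assume "infdist x S < R"
    moreover have "?r \<longlonglongrightarrow> R * (1 - 0)"
      by (intro tendsto_intros LIMSEQ_Suc[OF lim_1_over_n])
    ultimately have "\<forall>\<^sub>F n in sequentially. infdist x S < ?r n"
      by (intro order_tendstoD(1)) auto
    then obtain n where "infdist x S < ?r n"
      by (auto simp: eventually_sequentially)
    then show "x \<in> (\<Union>n. parallel_set S (?r n))"
      by (auto simp: parallel_set_def intro: less_imp_le)
  qed
  have sub: "{x. infdist x S < R} \<subseteq> parallel_set S R"
    by (auto simp: parallel_set_def)
  have [measurable, simp]: "{x. infdist x S < R} \<in> sets borel"
    by (simp add: borel_open open_Collect_less continuous_on_infdist)
  have fin': "emeasure lborel {x. infdist x S < R} \<noteq> \<infinity>"
  proof -
    have "emeasure lborel {x. infdist x S < R} \<le> emeasure lborel (parallel_set S R)"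
      by (intro emeasure_mono sub) measurable
    then show ?thesis
      using fin[of R] by (auto simp: top_unique)
  qed
  have "(\<lambda>n. measure lborel (parallel_set S (?r n))) \<longlonglongrightarrow> measure lborel (\<Union>n. parallel_set S (?r n))"
    using fin' r_mono unfolding U[symmetric]
    by (intro Lim_measure_incseq) (auto simp: incseq_def intro!: parallel_set_mono)
  moreover have "measure lborel {x. infdist x S < R} = measure lborel (parallel_set S R)"
  proof (rule measure_eq_AE)
    have "{x. infdist x S = R} \<in> null_sets lebesgue"
      using negligible_infdist_sphere[OF assms(1,3)] by (simp add: negligible_iff_null_sets)
    moreover have "{x. infdist x S = R} \<in> sets lborel"
      by (simp add: borel_closed closed_Collect_eq continuous_on_infdist)
    ultimately have "{x. infdist x S = R} \<in> null_sets lborel"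
      by (simp add: null_sets_completion_iff)
    then have "AE x in lborel. x \<notin> {x. infdist x S = R}"
      by (rule AE_not_in)
    then show "AE x in lborel. x \<in> {x. infdist x S < R} \<longleftrightarrow> x \<in> parallel_set S R"
      by eventually_elim (auto simp: parallel_set_def)
  qed simp_all
  ultimately show ?thesis
    unfolding volume_fun_def U by simp
qed

text \<open>The volume formula is assumed only for \<open>r < R\<close>, whereas the normalising
  constant of the uniform law is the volume at \<open>R\<close> itself.\<close>

lemma volume_fun_polynomial_at_end:
  assumes "compact S" "S \<noteq> {}" "0 < R"
    and V: "\<And>r. 0 \<le> r \<Longrightarrow> r < R \<Longrightarrow> volume_fun S r = measure lborel S + L * r + pi * r\<^sup>2"
  shows "volume_fun S R = measure lborel S + L * R + pi * R\<^sup>2"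
proof -
  let ?r = "\<lambda>n. R * (1 - 1 / real (Suc n))"
  have "volume_fun S (?r n) = measure lborel S + L * ?r n + pi * (?r n)\<^sup>2" for n
    using \<open>0 < R\<close> by (intro V) (auto simp: field_simps)
  then have "(\<lambda>n. measure lborel S + L * ?r n + pi * (?r n)\<^sup>2) \<longlonglongrightarrow> volume_fun S R"
    using volume_fun_tendsto[OF assms(1-3)] by simp
  moreover have "(\<lambda>n. measure lborel S + L * ?r n + pi * (?r n)\<^sup>2) \<longlonglongrightarrow>
      measure lborel S + L * (R * (1 - 0)) + pi * (R * (1 - 0))\<^sup>2"
    by (intro tendsto_intros LIMSEQ_Suc[OF lim_1_over_n])
  ultimately show ?thesis
    using LIMSEQ_unique by force
qed

text \<open>Under the uniform law the distribution function of the distance is a quotient of shell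
  volumes, both known from the volume formula; it is matched with the integral of the
  density.\<close>

lemma distributed_infdist_uniform:
  fixes S :: "(real^2) set"
  assumes M: "prob_space M" and R: "0 < R" and L: "0 < L" and S: "compact S"
    and V: "\<And>r. 0 \<le> r \<Longrightarrow> r < R \<Longrightarrow> volume_fun S r = measure lborel S + L * r + pi * r\<^sup>2"
    and X [measurable]: "X \<in> borel_measurable M"
    and X_distr: "distr M lborel X = uniform_measure lborel (parallel_set S R - S)"
  shows "distributed M lborel (\<lambda>\<omega>. infdist (X \<omega>) S) (\<lambda>r. ennreal (dist_density R L r))"
proof -
  interpret prob_space M by fact
  let ?f = "dist_density R L"
  let ?C = "L * R + pi * R\<^sup>2"
  let ?g = "\<lambda>a. if a < 0 then 0 else (L * min a R + pi * (min a R)\<^sup>2) / ?C"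
  have C: "0 < ?C"
    using R L by (simp add: add_pos_pos)
  \<comment> \<open>For empty \<open>S\<close> the volume function would be constant on
    \<open>r >= 0\<close>, while the assumed polynomial is strictly increasing there.\<close>
  have S_ne: "S \<noteq> {}"
  proof
    assume "S = {}"
    then have "volume_fun S (R / 2) = volume_fun S 0"
      using R by (simp add: volume_fun_def parallel_set_def infdist_def)
    also have "\<dots> = measure lborel S"
      using V[of 0] R by simp
    finally have "L * (R / 2) + pi * (R / 2)\<^sup>2 = 0"
      using V[of "R / 2"] R by simp
    moreover have "0 < L * (R / 2) + pi * (R / 2)\<^sup>2"
      using R L by (simp add: add_pos_pos)
    ultimately show False by linarith
  qed
  have [measurable]: "S \<in> sets borel" "parallel_set S r \<in> sets borel" for r
    using S compact_parallel_set[OF S S_ne] by (simp_all add: borel_compact)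
  have fin: "emeasure lborel (parallel_set S r) < \<infinity>" for r
    using emeasure_compact_finite[OF compact_parallel_set[OF S S_ne]] by simp
  have V': "measure lborel (parallel_set S r - S) = L * r + pi * r\<^sup>2" if "0 \<le> r" "r \<le> R" for r
  proof -
    have "volume_fun S r = measure lborel S + L * r + pi * r\<^sup>2"
      using that V volume_fun_polynomial_at_end[OF S S_ne R V] by (cases "r < R") auto
    moreover have "measure lborel (parallel_set S r - S) = volume_fun S r - measure lborel S"
      unfolding volume_fun_def using that fin[of r] subset_parallel_set[of r S]
      by (intro measure_Diff) auto
    ultimately show ?thesis by simp
  qed
  have em: "emeasure lborel (parallel_set S r - S) = ennreal (L * r + pi * r\<^sup>2)"
    if "0 \<le> r" "r \<le> R" for r
  proof -
    have "emeasure lborel (parallel_set S r - S) \<le> emeasure lborel (parallel_set S r)"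
      by (intro emeasure_mono) auto
    then have "emeasure lborel (parallel_set S r - S) \<noteq> top"
      using fin[of r] by (auto simp: top_unique)
    then show ?thesis
      using V'[OF that] by (simp add: emeasure_eq_ennreal_measure)
  qed
  show ?thesis
  proof (rule distributedI_borel_atMost[where g = ?g])
    show "(\<lambda>\<omega>. infdist (X \<omega>) S) \<in> borel_measurable M"
      using X by (rule measurable_compose)
        (intro borel_measurable_continuous_onI continuous_on_infdist continuous_on_id)
    show [measurable]: "?f \<in> borel_measurable borel"
      unfolding dist_density_def by measurable
    show "AE x in lborel. 0 \<le> ?f x"
      using C R L by (auto simp: dist_density_def)
  next
    fix a :: real
    show "(\<integral>\<^sup>+ x. ennreal (?f x * indicator {..a} x) \<partial>lborel) = ennreal (?g a)"
    proof (cases "a < 0")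
      case True
      then have "(\<integral>\<^sup>+ x. ennreal (?f x * indicator {..a} x) \<partial>lborel) = (\<integral>\<^sup>+ x. 0 \<partial>(lborel :: real measure))"
        by (intro nn_integral_cong) (auto simp: dist_density_def split: split_indicator)
      then show ?thesis using True by simp
    next
      case False
      let ?m = "min a R"
      \<comment> \<open>The density is \<open>0\<close> at \<open>R\<close>, but the closed interval
        used for the antiderivative may contain \<open>R\<close>; a single point is null.\<close>
      have "AE x in lborel. x \<noteq> R" by (rule AE_lborel_singleton)
      then have "(\<integral>\<^sup>+ x. ennreal (?f x * indicator {..a} x) \<partial>lborel) =
          (\<integral>\<^sup>+ x. ennreal ((L + 2 * pi * x) / ?C) * indicator {0..?m} x \<partial>lborel)"
        by (intro nn_integral_cong_AE, eventually_elim)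
           (auto simp: dist_density_def split: split_indicator)
      also have "\<dots> = ennreal ((L * ?m + pi * ?m\<^sup>2) / ?C - (L * 0 + pi * 0\<^sup>2) / ?C)"
      proof (rule nn_integral_FTC_Icc[where F = "\<lambda>x. (L * x + pi * x\<^sup>2) / ?C"])
        fix x :: real assume "x \<in> {0..?m}"
        then have "0 \<le> x" by simp
        show "((\<lambda>x. (L * x + pi * x\<^sup>2) / ?C) has_real_derivative (L + 2 * pi * x) / ?C) (at x)"
          using C by (auto intro!: derivative_eq_intros)
        show "0 \<le> (L + 2 * pi * x) / ?C"
          using C L \<open>0 \<le> x\<close> by simp
      qed (use False R in auto)
      finally show ?thesis using False by simp
    qed
    show "emeasure M {\<omega> \<in> space M. infdist (X \<omega>) S \<le> a} = ennreal (?g a)"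
    proof -
      have "emeasure M {\<omega> \<in> space M. infdist (X \<omega>) S \<le> a} = emeasure (distr M lborel X) (parallel_set S a)"
      proof -
        have "{\<omega> \<in> space M. infdist (X \<omega>) S \<le> a} = X -` parallel_set S a \<inter> space M"
          by (auto simp: parallel_set_def)
        then show ?thesis by (simp add: emeasure_distr)
      qed
      also have "\<dots> = emeasure lborel ((parallel_set S R - S) \<inter> parallel_set S a) /
          emeasure lborel (parallel_set S R - S)"
        unfolding X_distr by (intro emeasure_uniform_measure) auto
      also have "\<dots> = ennreal (?g a)"
      proof (cases "a < 0")
        case True
        have "x \<notin> parallel_set S a" for x
          using infdist_nonneg[of x S] True by (simp add: parallel_set_def)
        then have "parallel_set S a = {}" by auto
        then show ?thesis using True by simp
      next
        case False
        have "(parallel_set S R - S) \<inter> parallel_set S a = parallel_set S (min a R) - S"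
          by (auto simp: parallel_set_def)
        then show ?thesis
          using False R C L em[of "min a R"] em[of R]
          by (simp add: divide_ennreal flip: ennreal_plus)
      qed
      finally show ?thesis .
    qed
  qed
qed

section \<open>The likelihood equation\<close>

text \<open>The derivative of the log-likelihood times \<open>(t + \<pi> R)\<^sup>2\<close>. In this form every summand is
  visibly antitone in \<open>t\<close>, strictly unless \<open>2 d\<^sub>i = R\<close>.\<close>
definition lik_crit :: "real \<Rightarrow> nat \<Rightarrow> (nat \<Rightarrow> real) \<Rightarrow> real \<Rightarrow> real" where
  "lik_crit R n d t =
     (\<Sum>i<n. (pi * R - 2 * pi * d i) + (pi * R - 2 * pi * d i)\<^sup>2 / (t + 2 * pi * d i))"

text \<open>With \<open>u = pi * R - 2 * pi * d i\<close> and \<open>y = t + 2 * pi * d i\<close>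
  one has \<open>u + u^2 / y = (y + u) * u / y\<close>, and \<open>y + u = t + pi * R\<close> is the
  same for all \<open>i\<close>.\<close>

lemma lik_crit_eq:
  assumes "0 < t" "\<And>i. 0 \<le> d i"
  shows "lik_crit R n d t = (t + pi * R) * (\<Sum>i<n. (pi * R - 2 * pi * d i) / (t + 2 * pi * d i))"
  unfolding lik_crit_def sum_distrib_left
proof (rule sum.cong)
  fix i
  have "t + 2 * pi * d i \<noteq> 0"
    using assms(1) assms(2)[of i] by (simp add: add_pos_nonneg less_imp_neq[symmetric])
  then show "(pi * R - 2 * pi * d i) + (pi * R - 2 * pi * d i)\<^sup>2 / (t + 2 * pi * d i) =
      (t + pi * R) * ((pi * R - 2 * pi * d i) / (t + 2 * pi * d i))"
    by (simp add: divide_simps) (simp add: power2_eq_square algebra_simps)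
qed simp

text \<open>Each score term is \<open>(t + pi * R) / (t + 2 * pi * d i) - 1\<close>, so a vanishing
  sum is the likelihood equation. For \<open>n = 0\<close> the left side of that equation would be
  \<open>0\<close> and the right side positive.\<close>

lemma lik_crit_eq_0_iff:
  assumes "0 < t" "0 < R" "\<And>i. 0 \<le> d i" "1 \<le> n"
  shows "lik_crit R n d t = 0 \<longleftrightarrow> 1 / real n * (\<Sum>i<n. 1 / (t + 2 * pi * d i)) = 1 / (t + pi * R)"
proof -
  have pos: "0 < t + pi * R"
    using assms by (simp add: add_pos_pos)
  have "(\<Sum>i<n. (pi * R - 2 * pi * d i) / (t + 2 * pi * d i)) =
      (\<Sum>i<n. (t + pi * R) * (1 / (t + 2 * pi * d i)) - 1)"
  proof (rule sum.cong)
    fix i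
    have "t + 2 * pi * d i \<noteq> 0"
      using assms(1) assms(3)[of i] by (simp add: add_pos_nonneg less_imp_neq[symmetric])
    then show "(pi * R - 2 * pi * d i) / (t + 2 * pi * d i) = (t + pi * R) * (1 / (t + 2 * pi * d i)) - 1"
      by (simp add: divide_simps)
  qed simp
  also have "\<dots> = (t + pi * R) * (\<Sum>i<n. 1 / (t + 2 * pi * d i)) - real n"
    by (simp add: sum_subtractf sum_distrib_left)
  finally have "lik_crit R n d t = 0 \<longleftrightarrow> (t + pi * R) * (\<Sum>i<n. 1 / (t + 2 * pi * d i)) = real n"
    using pos by (simp add: lik_crit_eq[OF assms(1,3)])
  also have "\<dots> \<longleftrightarrow> 1 / real n * (\<Sum>i<n. 1 / (t + 2 * pi * d i)) = 1 / (t + pi * R)"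
    using pos assms(4) by (auto simp: field_simps)
  finally show ?thesis .
qed

text \<open>The log-likelihood need not be concave in \<open>L\<close>, so a critical point has to
  be compared directly with every other parameter.\<close>

lemma loglik_le_of_crit_eq_0:
  assumes "0 < L" "0 < t" "0 < R" "\<And>i. 0 \<le> d i" "lik_crit R n d t = 0"
  shows "loglik R n d L \<le> loglik R n d t"
proof -
  have posR: "0 < L + pi * R" "0 < t + pi * R"
    using assms by (simp_all add: add_pos_pos)
  have posd: "0 < L + 2 * pi * d i" "0 < t + 2 * pi * d i" for i
    using assms(1,2) assms(4)[of i] by (simp_all add: add_pos_nonneg)
  have loglik: "loglik R n d x = (\<Sum>i<n. ln (x + 2 * pi * d i) - ln (x + pi * R) - ln R)"
    if "0 < x" for x
  proof -
    have "x * R + pi * R\<^sup>2 = (x + pi * R) * R"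
      by (simp add: power2_eq_square algebra_simps)
    then have "ln (x * R + pi * R\<^sup>2) = ln (x + pi * R) + ln R"
      using that assms(3) by (simp add: ln_mult_pos add_pos_pos)
    then show ?thesis
      by (simp add: loglik_def sum_subtractf algebra_simps)
  qed
  have "loglik R n d L - loglik R n d t =
      (\<Sum>i<n. ln ((L + 2 * pi * d i) * (t + pi * R) / ((t + 2 * pi * d i) * (L + pi * R))))"
    unfolding loglik[OF assms(1)] loglik[OF assms(2)] sum_subtractf[symmetric]
    using posR posd posd[THEN less_imp_neq[THEN not_sym]] by (intro sum.cong) (simp_all add: ln_mult_pos ln_div)
  also have "\<dots> \<le> (\<Sum>i<n. (L + 2 * pi * d i) * (t + pi * R) / ((t + 2 * pi * d i) * (L + pi * R)) - 1)"
    using posR posd by (intro sum_mono ln_le_minus_one) simp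
  \<comment> \<open>A likelihood ratio minus one is the score term at \<open>t\<close> times a
    factor free of \<open>i\<close>; hence the bounds add up to a multiple of
    \<open>lik_crit\<close> at \<open>t\<close>.\<close>
  also have "\<dots> = (\<Sum>i<n. (L - t) / (L + pi * R) * ((pi * R - 2 * pi * d i) / (t + 2 * pi * d i)))"
  proof (intro sum.cong refl)
    fix i
    show "(L + 2 * pi * d i) * (t + pi * R) / ((t + 2 * pi * d i) * (L + pi * R)) - 1 =
        (L - t) / (L + pi * R) * ((pi * R - 2 * pi * d i) / (t + 2 * pi * d i))"
      using posR(1) posd(2)[of i] by (simp add: divide_simps) (simp add: algebra_simps)
  qed
  also have "\<dots> = (L - t) / (L + pi * R) * (\<Sum>i<n. (pi * R - 2 * pi * d i) / (t + 2 * pi * d i))"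
    by (simp add: sum_distrib_left)
  also have "\<dots> = 0"
    using assms(5) posR by (simp add: lik_crit_eq[OF assms(2,4)])
  finally show ?thesis by simp
qed

lemma loglik_has_derivative:
  assumes "0 < t" "0 < R" "\<And>i. 0 \<le> d i"
  shows "(loglik R n d has_real_derivative lik_crit R n d t / (t + pi * R)\<^sup>2) (at t)"
proof -
  have pos: "0 < t + pi * R" "0 < t * R + pi * R\<^sup>2"
    using assms by (simp_all add: add_pos_pos)
  have posd: "0 < t + 2 * pi * d i" for i
    using assms(1) assms(3)[of i] by (simp add: add_pos_nonneg)
  have "R / (t * R + pi * R\<^sup>2) = 1 / (t + pi * R)"
    using assms(2) pos by (simp add: divide_simps power2_eq_square) (simp add: algebra_simps)
  moreover have "lik_crit R n d t / (t + pi * R)\<^sup>2 =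
      (\<Sum>i<n. 1 / (t + 2 * pi * d i) - 1 / (t + pi * R))"
  proof -
    have "lik_crit R n d t / (t + pi * R)\<^sup>2 =
        (\<Sum>i<n. (pi * R - 2 * pi * d i) / (t + 2 * pi * d i)) / (t + pi * R)"
      using pos by (simp add: lik_crit_eq[OF assms(1,3)] power2_eq_square)
    also have "\<dots> = (\<Sum>i<n. 1 / (t + 2 * pi * d i) - 1 / (t + pi * R))"
      unfolding sum_divide_distrib
    proof (intro sum.cong refl)
      fix i
      show "(pi * R - 2 * pi * d i) / (t + 2 * pi * d i) / (t + pi * R) =
          1 / (t + 2 * pi * d i) - 1 / (t + pi * R)"
        using pos(1) posd[of i] by (simp add: divide_simps)
    qed
    finally show ?thesis .
  qed
  ultimately have eq: "lik_crit R n d t / (t + pi * R)\<^sup>2 =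
      - real n * (R / (t * R + pi * R\<^sup>2)) + (\<Sum>i<n. 1 / (t + 2 * pi * d i))"
    by (simp add: sum_subtractf)
  show ?thesis
    unfolding loglik_def[abs_def] eq
    using pos(2) posd by (auto intro!: derivative_eq_intros sum.cong simp: field_simps)
qed

lemma is_mle_iff_crit_eq_0:
  assumes "0 < R" "\<And>i. 0 \<le> d i"
  shows "is_mle R n d L \<longleftrightarrow> 0 < L \<and> lik_crit R n d L = 0"
proof
  assume mle: "is_mle R n d L"
  then have L: "0 < L" and max: "\<And>y. 0 < y \<Longrightarrow> loglik R n d y \<le> loglik R n d L"
    by (auto simp: is_mle_def is_arg_max_linorder)
  \<comment> \<open>A maximum on an open set is critical; radius \<open>L\<close> keeps the
    neighbourhood of \<open>L\<close> inside the parameter space.\<close>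
  have "lik_crit R n d L / (L + pi * R)\<^sup>2 = 0"
    using loglik_has_derivative[OF L assms] L
    by (rule DERIV_local_max) (auto intro: max simp: abs_less_iff)
  moreover have "0 < L + pi * R"
    using L assms(1) by (simp add: add_pos_pos)
  ultimately show "0 < L \<and> lik_crit R n d L = 0"
    using L by simp
next
  assume "0 < L \<and> lik_crit R n d L = 0"
  then show "is_mle R n d L"
    using loglik_le_of_crit_eq_0[of _ L R d n] assms by (auto simp: is_mle_def is_arg_max_linorder)
qed

section \<open>Sign, existence and uniqueness of the root of \<open>lik_crit\<close>\<close>

text \<open>If every \<open>d i\<close> equals \<open>R / 2\<close>, then \<open>lik_crit\<close> is
  identically \<open>0\<close>. A nonzero value at any \<open>u\<close> excludes this and supplies
  an index whose summand decreases strictly.\<close>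

lemma lik_crit_strict_antimono:
  assumes "0 < s" "s < t" "\<And>i. 0 \<le> d i" "lik_crit R n d u \<noteq> 0"
  shows "lik_crit R n d t < lik_crit R n d s"
proof -
  have "\<exists>i<n. pi * R - 2 * pi * d i \<noteq> 0"
    using assms(4) unfolding lik_crit_def by (rule contrapos_np) (auto intro!: sum.neutral)
  then obtain i where i: "i < n" "pi * R - 2 * pi * d i \<noteq> 0"
    by blast
  show ?thesis
    unfolding lik_crit_def
  proof (rule sum_strict_mono_ex1)
    show "\<forall>i\<in>{..<n}. (pi * R - 2 * pi * d i) + (pi * R - 2 * pi * d i)\<^sup>2 / (t + 2 * pi * d i) \<le>
        (pi * R - 2 * pi * d i) + (pi * R - 2 * pi * d i)\<^sup>2 / (s + 2 * pi * d i)"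
      using assms by (intro ballI add_left_mono divide_left_mono mult_pos_pos add_pos_nonneg) auto
    have "(pi * R - 2 * pi * d i)\<^sup>2 / (t + 2 * pi * d i) < (pi * R - 2 * pi * d i)\<^sup>2 / (s + 2 * pi * d i)"
      using assms i by (intro divide_strict_left_mono mult_pos_pos add_pos_nonneg) auto
    then show "\<exists>i\<in>{..<n}. (pi * R - 2 * pi * d i) + (pi * R - 2 * pi * d i)\<^sup>2 / (t + 2 * pi * d i) <
        (pi * R - 2 * pi * d i) + (pi * R - 2 * pi * d i)\<^sup>2 / (s + 2 * pi * d i)"
      using i by (intro bexI[of _ i]) auto
  qed simp
qed

text \<open>Turns a comparison of \<open>t\<close> with the estimator, which is only implicitly
  given, into the sign of an explicit sum over the sample.\<close>

lemma lik_crit_gt_0_iff: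
  assumes "0 < t" "0 < L" "\<And>i. 0 \<le> d i" "lik_crit R n d u \<noteq> 0" "lik_crit R n d L = 0"
  shows "0 < lik_crit R n d t \<longleftrightarrow> t < L"
  using lik_crit_strict_antimono[OF _ _ assms(3,4), of t L] lik_crit_strict_antimono[OF _ _ assms(3,4), of L t] assms
  by (cases t L rule: linorder_cases) auto

lemma lik_crit_root:
  assumes "0 < s" "s \<le> t" "\<And>i. 0 \<le> d i" "0 < lik_crit R n d s" "lik_crit R n d t < 0"
  obtains L where "0 < L" "lik_crit R n d L = 0"
proof -
  have "continuous_on {s..t} (lik_crit R n d)"
    unfolding lik_crit_def[abs_def]
  proof (intro continuous_intros ballI)
    fix i x assume "x \<in> {s..t}"
    then show "x + 2 * pi * d i \<noteq> 0"
      using assms(1) assms(3)[of i] by (simp add: add_pos_nonneg less_imp_neq[symmetric])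
  qed
  then obtain x where "s \<le> x" "x \<le> t" "lik_crit R n d x = 0"
    using IVT2'[of "lik_crit R n d" t 0 s] assms by auto
  then show thesis
    using assms(1) by (intro that[of x]) auto
qed

text \<open>A sign change does two things: it yields a root by the intermediate value theorem, and
  it excludes the constant case, so the root is unique.\<close>

lemma ex1_mle:
  assumes "0 < R" "0 < s" "s \<le> t" "\<And>i. 0 \<le> d i" "0 < lik_crit R n d s" "lik_crit R n d t < 0"
  shows "\<exists>!L. is_mle R n d L"
proof -
  obtain L where L: "0 < L" "lik_crit R n d L = 0"
    using lik_crit_root[OF assms(2-6)] by blast
  have "L' = L" if "0 < L'" "lik_crit R n d L' = 0" for L'
    using lik_crit_strict_antimono[of L L' d R n s] lik_crit_strict_antimono[of L' L d R n s] L that assms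
    by (cases L L' rule: linorder_cases) auto
  with L show ?thesis
    by (auto simp: is_mle_iff_crit_eq_0[OF assms(1,4)])
qed

text \<open>The right-hand side is a countable union of measurable conditions on the sample.\<close>
lemma ex1_mle_iff:
  assumes "0 < R" "\<And>i. 0 \<le> d i"
  shows "(\<exists>!L. is_mle R n d L) \<longleftrightarrow>
    (\<exists>p q :: rat. 0 < p \<and> p \<le> q \<and> 0 < lik_crit R n d (of_rat p) \<and> lik_crit R n d (of_rat q) < 0)"
proof
  assume ex1: "\<exists>!L. is_mle R n d L"
  then obtain L where L: "0 < L" "lik_crit R n d L = 0"
    by (auto simp: is_mle_iff_crit_eq_0[OF assms])
  have uniq: "lik_crit R n d u \<noteq> 0" if "0 < u" "u \<noteq> L" for u
    using ex1 L that by (auto simp: is_mle_iff_crit_eq_0[OF assms])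
  \<comment> \<open>By uniqueness \<open>L + 1\<close> is not a second root; it serves as the
    witness that \<open>lik_crit\<close> is not identically zero.\<close>
  then have ne: "lik_crit R n d (L + 1) \<noteq> 0"
    using L by simp
  obtain p q where pq: "0 < (of_rat p :: real)" "of_rat p < L" "L < of_rat q"
    using of_rat_dense[of 0 L] of_rat_dense[of L "L + 1"] L(1) by (metis less_add_one)
  have "0 < lik_crit R n d (of_rat p)"
    using lik_crit_strict_antimono[OF pq(1,2) assms(2) ne] L by simp
  moreover have "lik_crit R n d (of_rat q) < 0"
    using lik_crit_strict_antimono[OF L(1) pq(3) assms(2) ne] L by simp
  moreover have "p \<le> q"
  proof -
    have "(of_rat p :: real) \<le> of_rat q" using pq by linarith
    then show ?thesis by (simp add: of_rat_less_eq)
  qed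
  ultimately show "\<exists>p q. 0 < p \<and> p \<le> q \<and> 0 < lik_crit R n d (of_rat p) \<and> lik_crit R n d (of_rat q) < 0"
    using pq(1) by (auto simp: zero_less_of_rat_iff)
next
  assume "\<exists>p q :: rat. 0 < p \<and> p \<le> q \<and> 0 < lik_crit R n d (of_rat p) \<and> lik_crit R n d (of_rat q) < 0"
  then obtain p q :: rat where pq: "0 < p" "p \<le> q" "0 < lik_crit R n d (of_rat p)" "lik_crit R n d (of_rat q) < 0"
    by blast
  then show "\<exists>!L. is_mle R n d L"
    by (intro ex1_mle[OF assms(1) _ _ assms(2), of "of_rat p" "of_rat q"])
       (auto simp: of_rat_less_eq zero_less_of_rat_iff)
qed

text \<open>A measurable selection of a maximiser: \<open>lik_crit\<close> is positive exactly to the left of its root,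
  so the root is a countable supremum. The value \<open>1\<close> covers the samples with \<open>2 d\<^sub>i = R\<close> for all
  \<open>i\<close>, whose likelihood is constant.\<close>
definition lik_root :: "real \<Rightarrow> nat \<Rightarrow> (nat \<Rightarrow> real) \<Rightarrow> ereal" where
  "lik_root R n d =
     (SUP q::rat. if 0 < q \<and> 0 < lik_crit R n d (of_rat q) then ereal (of_rat q) else 0)"

definition mle_fun :: "real \<Rightarrow> nat \<Rightarrow> (nat \<Rightarrow> real) \<Rightarrow> real" where
  "mle_fun R n d = (if lik_root R n d = 0 then 1 else real_of_ereal (lik_root R n d))"

lemma is_mle_mle_fun:
  assumes "0 < R" "\<And>i. 0 \<le> d i" "is_mle R n d L"
  shows "is_mle R n d (mle_fun R n d)"
proof (cases "\<exists>u. lik_crit R n d u \<noteq> 0")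
  case True
  then obtain u where u: "lik_crit R n d u \<noteq> 0" by blast
  have L: "0 < L" "lik_crit R n d L = 0"
    using assms(3) by (auto simp: is_mle_iff_crit_eq_0[OF assms(1,2)])
  have iff: "0 < lik_crit R n d t \<longleftrightarrow> t < L" if "0 < t" for t
    by (rule lik_crit_gt_0_iff[OF that L(1) assms(2) u L(2)])
  \<comment> \<open>The default \<open>0\<close> in the supremum is below \<open>L\<close> and so is
    harmless. The extended reals are needed for samples without a maximiser, where
    \<open>lik_crit\<close> can be positive on the whole half-line.\<close>
  have "lik_root R n d = ereal L"
    unfolding lik_root_def
  proof (rule SUP_eqI)
    fix q :: rat
    show "(if 0 < q \<and> 0 < lik_crit R n d (of_rat q) then ereal (of_rat q) else 0) \<le> ereal L"
      using L(1) iff[of "of_rat q"] by (auto simp: zero_less_of_rat_iff intro: less_imp_le)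
  next
    fix y :: ereal
    assume y: "\<And>q::rat. q \<in> UNIV \<Longrightarrow>
      (if 0 < q \<and> 0 < lik_crit R n d (of_rat q) then ereal (of_rat q) else 0) \<le> y"
    show "ereal L \<le> y"
    proof (rule dense_le)
      fix z assume "z < ereal L"
      then obtain x where x: "z \<le> ereal x" "0 < x" "x < L"
      proof (cases z)
        case (real r)
        then show thesis
          using that[of "max r (L / 2)"] \<open>z < ereal L\<close> L(1) by auto
      next
        case MInf
        then show thesis
          using that[of "L / 2"] L(1) by auto
      qed auto
      obtain q where q: "x < of_rat q" "of_rat q < L"
        using of_rat_dense[OF x(3)] by blast
      then have "0 < q"
        using x(2) by (metis order_less_trans zero_less_of_rat_iff)
      then have "ereal (of_rat q) \<le> y"
        using y[of q] iff[of "of_rat q"] q by (simp add: zero_less_of_rat_iff)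
      with x(1) q(1) show "z \<le> y"
        by (meson less_ereal.simps(1) less_imp_le order_trans)
    qed
  qed
  then have "mle_fun R n d = L"
    using L by (simp add: mle_fun_def)
  then show ?thesis using assms(3) by simp
next
  \<comment> \<open>Here \<open>lik_crit\<close> vanishes identically, so every positive number is a
    maximiser.\<close>
  case False
  then have "lik_root R n d = 0"
    by (simp add: lik_root_def)
  then have "mle_fun R n d = 1"
    by (simp add: mle_fun_def)
  then show ?thesis
    using False by (simp add: is_mle_iff_crit_eq_0[OF assms(1,2)])
qed

section \<open>Limit theorems\<close>

text \<open>Hoeffding's inequality bounds the deviation probability by a geometric sequence in
  \<open>n\<close>.\<close>

lemma (in prob_space) weak_law_of_large_numbers_bounded:
  fixes Y :: "nat \<Rightarrow> 'a \<Rightarrow> real"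
  assumes indep: "indep_vars (\<lambda>_. borel) Y UNIV"
    and distr: "\<And>i. distr M borel (Y i) = distr M borel (Y 0)"
    and bound: "\<And>\<omega>. \<omega> \<in> space M \<Longrightarrow> \<bar>Y 0 \<omega>\<bar> \<le> b"
    and "0 < \<epsilon>"
  shows "(\<lambda>n. prob {\<omega> \<in> space M. \<epsilon> \<le> \<bar>(\<Sum>i<n. Y i \<omega>) / real n - expectation (Y 0)\<bar>}) \<longlonglongrightarrow> 0"
proof (rule tendsto_sandwich[where f = "\<lambda>_. 0" and
      h = "\<lambda>n. 2 * exp (-2 * real n * \<epsilon>\<^sup>2 / ((b + 1) - (- b - 1))\<^sup>2)"])
  let ?q = "\<lambda>n. 2 * exp (-2 * real n * \<epsilon>\<^sup>2 / ((b + 1) - (- b - 1))\<^sup>2)"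
  obtain \<omega> where "\<omega> \<in> space M" using not_empty by blast
  then have b: "0 \<le> b" using bound[of \<omega>] by linarith
  show "\<forall>\<^sub>F n in sequentially. prob {\<omega> \<in> space M. \<epsilon> \<le> \<bar>(\<Sum>i<n. Y i \<omega>) / real n - expectation (Y 0)\<bar>} \<le> ?q n"
    using eventually_gt_at_top[of 0]
  proof eventually_elim
    fix n :: nat assume n: "0 < n"
    \<comment> \<open>The range is widened by \<open>1\<close> on both sides so that its length is
      positive even for \<open>b = 0\<close>.\<close>
    interpret H: Hoeffding_ineq_iid M "{..<n}" Y "Y 0" "- b - 1" "b + 1" "expectation (Y 0)"
    proof unfold_locales
      show "indep_vars (\<lambda>_. borel) Y {..<n}"
        using indep_vars_subset[OF indep] by blast
      show "random_variable borel (Y 0)"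
        using indep by (simp add: indep_vars_def)
      show "AE x in M. Y 0 x \<in> {- b - 1..b + 1}"
        using bound by (intro AE_I2) (fastforce simp: abs_le_iff)
    qed (use distr in simp_all)
    show "prob {\<omega> \<in> space M. \<epsilon> \<le> \<bar>(\<Sum>i<n. Y i \<omega>) / real n - expectation (Y 0)\<bar>} \<le> ?q n"
    proof -
      have "{..<n} \<noteq> {}" using n by auto
      from H.Hoeffding_ineq_abs_ge'[OF _ _ this, of \<epsilon>] b \<open>0 < \<epsilon>\<close> show ?thesis by simp
    qed
  qed
  have "-2 * real n * \<epsilon>\<^sup>2 / ((b + 1) - (- b - 1))\<^sup>2 =
      real n * - (2 * \<epsilon>\<^sup>2 / ((b + 1) - (- b - 1))\<^sup>2)" for n
    by simp
  then have "?q = (\<lambda>n. 2 * exp (- (2 * \<epsilon>\<^sup>2 / ((b + 1) - (- b - 1))\<^sup>2)) ^ n)"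
    by (simp only: exp_of_nat_mult)
  moreover have "(\<lambda>n. 2 * exp (- (2 * \<epsilon>\<^sup>2 / ((b + 1) - (- b - 1))\<^sup>2)) ^ n) \<longlonglongrightarrow> 2 * 0"
    using b \<open>0 < \<epsilon>\<close> by (intro tendsto_intros LIMSEQ_realpow_zero) auto
  ultimately show "?q \<longlonglongrightarrow> 0" by simp
qed auto

text \<open>A form of Slutsky's theorem. Unless \<open>Z n\<close> is at least
  \<open>\<delta>\<close> away from \<open>z\<close>, the event lies between
  \<open>W n <= z - \<delta>\<close> and \<open>W n <= z + \<delta>\<close>; continuity of
  \<open>F\<close> at \<open>z\<close> closes the gap.\<close>

lemma (in prob_space) prob_le_tendsto_cdf:
  fixes W Z :: "nat \<Rightarrow> 'a \<Rightarrow> real"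
  assumes [measurable]: "\<And>n. W n \<in> borel_measurable M" "\<And>n. Z n \<in> borel_measurable M"
    and W: "\<And>x. (\<lambda>n. prob {\<omega> \<in> space M. W n \<omega> \<le> x}) \<longlonglongrightarrow> F x"
    and Z: "\<And>\<epsilon>. 0 < \<epsilon> \<Longrightarrow> (\<lambda>n. prob {\<omega> \<in> space M. \<epsilon> \<le> \<bar>Z n \<omega> - z\<bar>}) \<longlonglongrightarrow> 0"
    and F: "isCont F z"
  shows "(\<lambda>n. prob {\<omega> \<in> space M. W n \<omega> \<le> Z n \<omega>}) \<longlonglongrightarrow> F z"
proof (rule LIMSEQ_I)
  fix e :: real assume e: "0 < e"
  let ?P = "\<lambda>n. prob {\<omega> \<in> space M. W n \<omega> \<le> Z n \<omega>}"
  let ?A = "\<lambda>n x. prob {\<omega> \<in> space M. W n \<omega> \<le> x}"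
  from F e obtain d where d: "0 < d" "\<And>x. \<bar>x - z\<bar> < d \<Longrightarrow> \<bar>F x - F z\<bar> < e / 3"
    unfolding continuous_at_eps_delta dist_real_def
    by (meson divide_pos_pos zero_less_numeral)
  define \<delta> where "\<delta> = d / 2"
  have \<delta>: "0 < \<delta>" "\<bar>F (z + \<delta>) - F z\<bar> < e / 3" "\<bar>F (z - \<delta>) - F z\<bar> < e / 3"
    using d by (auto simp: \<delta>_def)
  let ?B = "\<lambda>n. prob {\<omega> \<in> space M. \<delta> \<le> \<bar>Z n \<omega> - z\<bar>}"
  have ev: "\<forall>\<^sub>F n in sequentially. dist (?A n (z + \<delta>)) (F (z + \<delta>)) < e / 3"
    "\<forall>\<^sub>F n in sequentially. dist (?A n (z - \<delta>)) (F (z - \<delta>)) < e / 3"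
    "\<forall>\<^sub>F n in sequentially. dist (?B n) 0 < e / 3"
    using e by (intro tendstoD[OF W] tendstoD[OF Z[OF \<delta>(1)]]; simp)+
  have upper: "?P n \<le> ?A n (z + \<delta>) + ?B n" for n
  proof -
    have "?P n \<le> prob ({\<omega> \<in> space M. W n \<omega> \<le> z + \<delta>} \<union> {\<omega> \<in> space M. \<delta> \<le> \<bar>Z n \<omega> - z\<bar>})"
      by (intro finite_measure_mono) auto
    also have "\<dots> \<le> ?A n (z + \<delta>) + ?B n"
      by (intro measure_Un_le) auto
    finally show ?thesis .
  qed
  have lower: "?A n (z - \<delta>) \<le> ?P n + ?B n" for n
  proof -
    have "?A n (z - \<delta>) \<le> prob ({\<omega> \<in> space M. W n \<omega> \<le> Z n \<omega>} \<union> {\<omega> \<in> space M. \<delta> \<le> \<bar>Z n \<omega> - z\<bar>})"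
      by (intro finite_measure_mono) auto
    also have "\<dots> \<le> ?P n + ?B n"
      by (intro measure_Un_le) auto
    finally show ?thesis .
  qed
  have "\<forall>\<^sub>F n in sequentially. norm (?P n - F z) < e"
    using ev
  proof eventually_elim
    case (elim n)
    then show ?case
      using \<delta>(2,3) upper[of n] lower[of n] unfolding dist_real_def real_norm_def by linarith
  qed
  then show "\<exists>N. \<forall>n\<ge>N. norm (?P n - F z) < e"
    by (simp add: eventually_sequentially)
qed

text \<open>The central limit theorem yields the standard normal law; this translates its
  distribution function to the law with standard deviation \<open>\<tau>\<close>.\<close>

lemma cdf_normal_scale:
  assumes "0 < \<tau>"
  shows "cdf (density lborel (normal_density 0 \<tau>)) x = cdf std_normal_distribution (x / \<tau>)"
proof -
  interpret N: prob_space "std_normal_distribution"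
    by (intro prob_space_normal_density) simp
  have "distributed std_normal_distribution lborel (\<lambda>x. x) std_normal_density"
    by (auto simp: distributed_def intro!: distr_id2)
  from N.normal_density_affine[OF this _ _, of \<tau> 0] assms
  have "distributed std_normal_distribution lborel (\<lambda>x. \<tau> * x) (normal_density 0 \<tau>)"
    by simp
  then have "density lborel (normal_density 0 \<tau>) = distr std_normal_distribution lborel (\<lambda>x. \<tau> * x)"
    by (simp add: distributed_distr_eq_density)
  then have "cdf (density lborel (normal_density 0 \<tau>)) x =
      measure std_normal_distribution ((\<lambda>x. \<tau> * x) -` {..x} \<inter> space std_normal_distribution)"
    by (simp add: cdf_def measure_distr)
  also have "(\<lambda>x. \<tau> * x) -` {..x} \<inter> space std_normal_distribution = {..x / \<tau>}"
    using assms by (auto simp: field_simps)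
  finally show ?thesis by (simp add: cdf_def)
qed

lemma isCont_cdf_std_normal: "isCont (cdf std_normal_distribution) x"
proof -
  interpret prob_space "std_normal_distribution"
    by (intro prob_space_normal_density) simp
  interpret real_distribution "std_normal_distribution"
    by unfold_locales auto
  have "emeasure std_normal_distribution {x} = (\<integral>\<^sup>+ y. ennreal (std_normal_density y) * indicator {x} y \<partial>lborel)"
    by (simp add: emeasure_density)
  also have "\<dots> = 0"
    using AE_lborel_singleton[of x] by (auto simp: nn_integral_0_iff_AE elim: eventually_mono)
  finally show ?thesis
    unfolding isCont_cdf by (simp add: measure_def)
qed

lemma tendsto_add_divide_sqrt: "(\<lambda>n. a + x / sqrt (real n)) \<longlonglongrightarrow> a" for a x :: real
  by real_asymp

section \<open>Score and Fisher information\<close>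

text \<open>At \<open>x = 2 * pi * R / L\<close> this is the strict positivity of the Fisher
  information. The two sides agree at \<open>0\<close>, and their difference has a positive
  derivative beyond it.\<close>

lemma ln_one_plus_gt_Pade:
  fixes x :: real
  assumes "0 < x"
  shows "2 * x / (2 + x) < ln (1 + x)"
proof -
  have "(\<lambda>x. ln (1 + x) - 2 * x / (2 + x)) 0 < (\<lambda>x. ln (1 + x) - 2 * x / (2 + x)) x"
  proof (rule DERIV_pos_imp_increasing_open[OF assms])
    fix y :: real assume y: "0 < y" "y < x"
    have "((\<lambda>x. ln (1 + x) - 2 * x / (2 + x)) has_real_derivative
        1 / (1 + y) - (2 * (2 + y) - 2 * y) / (2 + y)\<^sup>2) (at y)"
      using y by (auto intro!: derivative_eq_intros simp: power2_eq_square)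
    moreover have "1 / (1 + y) - (2 * (2 + y) - 2 * y) / (2 + y)\<^sup>2 = y\<^sup>2 / ((1 + y) * (2 + y)\<^sup>2)"
      using y by (simp add: divide_simps) (simp add: power2_eq_square algebra_simps)
    moreover have "0 < y\<^sup>2 / ((1 + y) * (2 + y)\<^sup>2)"
      using y by simp
    ultimately show "\<exists>z. ((\<lambda>x. ln (1 + x) - 2 * x / (2 + x)) has_real_derivative z) (at y) \<and> 0 < z"
      by metis
  next
    show "continuous_on {0..x} (\<lambda>x. ln (1 + x) - 2 * x / (2 + x))"
      by (intro continuous_intros) auto
  qed
  then show ?thesis by simp
qed

text \<open>\<open>L + \<pi> R\<close> times the score of one observation, and its variance.\<close>
definition scaled_score :: "real \<Rightarrow> real \<Rightarrow> real \<Rightarrow> real" where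
  "scaled_score R L r = (pi * R - 2 * pi * r) / (L + 2 * pi * r)"

definition scaled_info :: "real \<Rightarrow> real \<Rightarrow> real" where
  "scaled_info R L = (L + pi * R) * (1 / (2 * pi * R) * ln (1 + 2 * pi * R / L)) - 1"

lemma borel_measurable_scaled_score [measurable]: "scaled_score R L \<in> borel_measurable borel"
  unfolding scaled_score_def[abs_def] by measurable

lemma borel_measurable_dist_density [measurable]: "dist_density R L \<in> borel_measurable borel"
  unfolding dist_density_def[abs_def] by measurable

lemma dist_density_nonneg: "0 < R \<Longrightarrow> 0 < L \<Longrightarrow> 0 \<le> dist_density R L r"
  by (simp add: dist_density_def)

section \<open>Mean and variance of the scaled score\<close>

lemma integral_dist_density:
  assumes "0 < R" "0 < L"
    and [measurable]: "g \<in> borel_measurable borel"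
    and F: "\<And>r. 0 \<le> r \<Longrightarrow> r \<le> R \<Longrightarrow> (F has_real_derivative (L + 2 * pi * r) * g r) (at r)"
    and g: "\<And>r. 0 \<le> r \<Longrightarrow> r \<le> R \<Longrightarrow> isCont g r"
  shows "(\<integral>r. dist_density R L r * g r \<partial>lborel) = (F R - F 0) / (L * R + pi * R\<^sup>2)"
proof -
  let ?C = "L * R + pi * R\<^sup>2"
  have "AE r in lborel. r \<noteq> R" by (rule AE_lborel_singleton)
  then have ae: "AE r in lborel. dist_density R L r * g r = (L + 2 * pi * r) * g r * indicator {0..R} r / ?C"
    by eventually_elim (auto simp: dist_density_def split: split_indicator)
  have hb: "has_bochner_integral lborel (\<lambda>r. (L + 2 * pi * r) * g r * indicator {0..R} r) (F R - F 0)"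
    using assms(1) F g by (intro has_bochner_integral_FTC_Icc_real) (auto intro!: continuous_intros)
  then have hb': "has_bochner_integral lborel (\<lambda>r. (L + 2 * pi * r) * g r * indicator {0..R} r / ?C)
      ((F R - F 0) / ?C)"
    by (rule has_bochner_integral_divide_zero)
  have "(\<integral>r. dist_density R L r * g r \<partial>lborel) =
      (\<integral>r. (L + 2 * pi * r) * g r * indicator {0..R} r / ?C \<partial>lborel)"
    by (rule integral_cong_AE[OF _ _ ae]) measurable
  then show ?thesis
    using hb' by (simp add: has_bochner_integral_iff)
qed

lemma integral_scaled_score:
  assumes "0 < R" "0 < L"
  shows "(\<integral>r. dist_density R L r * scaled_score R L r \<partial>lborel) = 0"
proof -
  have pos: "0 < L + 2 * pi * r" if "0 \<le> r" for r
    using assms that by (simp add: add_pos_nonneg)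
  have "(\<integral>r. dist_density R L r * scaled_score R L r \<partial>lborel) =
      ((pi * R * R - pi * R\<^sup>2) - (pi * R * 0 - pi * 0\<^sup>2)) / (L * R + pi * R\<^sup>2)"
  \<comment> \<open>The density cancels the denominator of the score and leaves
    \<open>pi * R - 2 * pi * r\<close>, whose antiderivative takes the same value at
    \<open>0\<close> and at \<open>R\<close>.\<close>
  proof (rule integral_dist_density[OF assms borel_measurable_scaled_score, where F = "\<lambda>r. pi * R * r - pi * r\<^sup>2"])
    fix r assume r: "0 \<le> r" "r \<le> R"
    show "((\<lambda>r. pi * R * r - pi * r\<^sup>2) has_real_derivative (L + 2 * pi * r) * scaled_score R L r) (at r)"
      using pos[OF r(1)] by (auto intro!: derivative_eq_intros simp: scaled_score_def)
    show "isCont (scaled_score R L) r"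
      using pos[OF r(1)] unfolding scaled_score_def[abs_def] by (intro continuous_intros) auto
  qed
  then show ?thesis by (simp add: power2_eq_square)
qed

lemma integral_scaled_score_sq:
  assumes "0 < R" "0 < L"
  shows "(\<integral>r. dist_density R L r * (scaled_score R L r)\<^sup>2 \<partial>lborel) = scaled_info R L"
proof -
  \<comment> \<open>With \<open>A = L + pi * R\<close> and \<open>y = L + 2 * pi * r\<close> the
    scaled score is \<open>(A - y) / y\<close>, so \<open>y\<close> times its square is
    \<open>A^2 / y - 2 * A + y\<close>; this is integrated in \<open>r\<close>.\<close>
  let ?F = "\<lambda>r. (L + pi * R)\<^sup>2 * ln (L + 2 * pi * r) / (2 * pi) - 2 * (L + pi * R) * r + L * r + pi * r\<^sup>2"
  have pos: "0 < L + 2 * pi * r" if "0 \<le> r" for r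
    using assms that by (simp add: add_pos_nonneg)
  have posR: "0 < L + pi * R"
    using assms by (simp add: add_pos_pos)
  have "(\<integral>r. dist_density R L r * (scaled_score R L r)\<^sup>2 \<partial>lborel) =
      (?F R - ?F 0) / (L * R + pi * R\<^sup>2)"
  proof (rule integral_dist_density[OF assms])
    show "(\<lambda>r. (scaled_score R L r)\<^sup>2) \<in> borel_measurable borel" by measurable
  next
    fix r assume r: "0 \<le> r" "r \<le> R"
    have "(?F has_real_derivative (L + pi * R)\<^sup>2 / (L + 2 * pi * r) - 2 * (L + pi * R) + L + 2 * pi * r) (at r)"
      using pos[OF r(1)] by (auto intro!: derivative_eq_intros)
    also have "(L + pi * R)\<^sup>2 / (L + 2 * pi * r) - 2 * (L + pi * R) + L + 2 * pi * r =
        (L + 2 * pi * r) * (scaled_score R L r)\<^sup>2"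
      using pos[OF r(1)] by (simp add: scaled_score_def divide_simps) (simp add: power2_eq_square algebra_simps)
    finally show "(?F has_real_derivative (L + 2 * pi * r) * (scaled_score R L r)\<^sup>2) (at r)" .
    show "isCont (\<lambda>r. (scaled_score R L r)\<^sup>2) r"
      using pos[OF r(1)] unfolding scaled_score_def[abs_def] by (intro continuous_intros) auto
  qed
  also have "?F R - ?F 0 = (L + pi * R)\<^sup>2 / (2 * pi) * (ln (L + 2 * pi * R) - ln L)
      - 2 * (L + pi * R) * R + (L * R + pi * R\<^sup>2)"
    by (simp add: right_diff_distrib)
  also have "ln (L + 2 * pi * R) - ln L = ln (1 + 2 * pi * R / L)"
  proof -
    have "1 + 2 * pi * R / L = (L + 2 * pi * R) / L"
      using assms by (simp add: add_divide_distrib)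
    then show ?thesis
      using assms pos[of R] by (simp add: ln_div)
  qed
  also have C: "L * R + pi * R\<^sup>2 = (L + pi * R) * R"
    by (simp add: power2_eq_square distrib_right)
  also have "((L + pi * R)\<^sup>2 / (2 * pi) * ln (1 + 2 * pi * R / L) - 2 * (L + pi * R) * R + (L + pi * R) * R) /
      ((L + pi * R) * R) = scaled_info R L"
  proof -
    have "(A\<^sup>2 / (2 * pi) * l - 2 * A * R + A * R) / (A * R) = A * (1 / (2 * pi * R) * l) - 1"
      if "0 < A" for A l :: real
      using that assms(1) by (simp add: diff_divide_distrib add_divide_distrib power2_eq_square)
    from this[OF posR] show ?thesis
      by (simp only: scaled_info_def)
  qed
  finally show ?thesis .
qed

lemma scaled_info_eq:
  assumes "0 < R" "0 < L"
  shows "scaled_info R L = (L + pi * R) * (1 / (2 * pi * R) * ln (1 + 2 * pi * R / L) - 1 / (L + pi * R))"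
proof -
  have "0 < L + pi * R"
    using assms by (simp add: add_pos_pos)
  then show ?thesis
    by (simp add: scaled_info_def right_diff_distrib)
qed

lemma scaled_info_pos:
  assumes "0 < R" "0 < L"
  shows "0 < scaled_info R L"
proof -
  have pos: "0 < L + pi * R"
    using assms by (simp add: add_pos_pos)
  have "2 * (2 * pi * R / L) / (2 + 2 * pi * R / L) < ln (1 + 2 * pi * R / L)"
    using assms by (intro ln_one_plus_gt_Pade) simp
  also have "2 * (2 * pi * R / L) / (2 + 2 * pi * R / L) = 2 * pi * R * (1 / (L + pi * R))"
    using assms pos by (simp add: divide_simps)
  finally have "1 / (L + pi * R) < 1 / (2 * pi * R) * ln (1 + 2 * pi * R / L)"
    using assms by (simp add: field_simps)
  then show ?thesis
    using pos by (simp add: scaled_info_eq[OF assms])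
qed

lemma asymp_var_eq:
  assumes "0 < R" "0 < L"
  shows "asymp_var R L = (L + pi * R)\<^sup>2 / scaled_info R L"
proof -
  have "0 < L + pi * R"
    using assms by (simp add: add_pos_pos)
  moreover have "A * inverse B = A\<^sup>2 / (A * B)" if "0 < A" for A B :: real
    using that by (simp add: power2_eq_square divide_inverse)
  ultimately show ?thesis
    unfolding asymp_var_def scaled_info_eq[OF assms] by blast
qed

text \<open>The support \<open>[0, R)\<close> does not move with the parameter, and on it the score
  is \<open>scaled_score\<close> divided by \<open>L + pi * R\<close>; the second moment computed
  above does the rest.\<close>

lemma fisher_information_dist_density:
  assumes "0 < R" "0 < L"
  shows "fisher_information (dist_density R) L = scaled_info R L / (L + pi * R)\<^sup>2"
proof -
  have posR: "0 < L + pi * R"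
    using assms by (simp add: add_pos_pos)
  have deriv: "deriv (\<lambda>t. ln (dist_density R t r)) L = scaled_score R L r / (L + pi * R)"
    if r: "0 \<le> r" "r < R" for r
  proof (rule DERIV_imp_deriv)
    have pos: "0 < L + 2 * pi * r" "0 < L * R + pi * R\<^sup>2"
      using assms r by (simp_all add: add_pos_nonneg add_pos_pos)
    have "((\<lambda>t. ln ((t + 2 * pi * r) / (t * R + pi * R\<^sup>2))) has_real_derivative
        (1 / (L + 2 * pi * r) - R / (L * R + pi * R\<^sup>2))) (at L)"
      using pos by (auto intro!: derivative_eq_intros) (simp add: divide_simps)
    also have "(\<lambda>t. ln ((t + 2 * pi * r) / (t * R + pi * R\<^sup>2))) = (\<lambda>t. ln (dist_density R t r))"
      using r by (simp add: dist_density_def)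
    also have "1 / (L + 2 * pi * r) - R / (L * R + pi * R\<^sup>2) = scaled_score R L r / (L + pi * R)"
    proof -
      have "L * R + pi * R\<^sup>2 = (L + pi * R) * R"
        by (simp add: power2_eq_square algebra_simps)
      then show ?thesis
        using pos(1) posR assms by (simp add: scaled_score_def divide_simps)
    qed
    finally show "((\<lambda>t. ln (dist_density R t r)) has_real_derivative scaled_score R L r / (L + pi * R)) (at L)" .
  qed
  \<comment> \<open>Off the support the density is \<open>0\<close> for every \<open>t\<close>, and
    \<open>ln 0 = 0\<close>, so the derivative is that of a constant.\<close>
  have deriv_out: "deriv (\<lambda>t. ln (dist_density R t r)) L = 0" if "\<not> (0 \<le> r \<and> r < R)" for r
  proof -
    have "(\<lambda>t. ln (dist_density R t r)) = (\<lambda>t. 0)"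
      using that by (auto simp: dist_density_def)
    then show ?thesis by simp
  qed
  have eq: "(\<lambda>r. (deriv (\<lambda>t. ln (dist_density R t r)) L)\<^sup>2) =
      (\<lambda>r. if 0 \<le> r \<and> r < R then (scaled_score R L r)\<^sup>2 / (L + pi * R)\<^sup>2 else 0)"
    by (auto simp: deriv deriv_out power_divide)
  have "fisher_information (dist_density R) L =
      (\<integral>r. dist_density R L r * (if 0 \<le> r \<and> r < R then (scaled_score R L r)\<^sup>2 / (L + pi * R)\<^sup>2 else 0) \<partial>lborel)"
    unfolding fisher_information_def eq using dist_density_nonneg[OF assms]
    by (subst integral_real_density) auto
  also have "\<dots> = (\<integral>r. dist_density R L r * (scaled_score R L r)\<^sup>2 / (L + pi * R)\<^sup>2 \<partial>lborel)"
    by (intro Bochner_Integration.integral_cong) (auto simp: dist_density_def)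
  also have "\<dots> = scaled_info R L / (L + pi * R)\<^sup>2"
    by (simp add: integral_scaled_score_sq[OF assms])
  finally show ?thesis .
qed

text \<open>The bound covers all \<open>r >= 0\<close> because the distances are nonnegative
  everywhere but below \<open>R\<close> only almost surely.\<close>

lemma abs_scaled_score_le:
  assumes "0 < R" "0 < L" "0 \<le> r"
  shows "\<bar>scaled_score R L r\<bar> \<le> 1 + pi * R / L"
proof -
  have pos: "0 < L + 2 * pi * r"
    using assms by (simp add: add_pos_nonneg)
  have "\<bar>pi * R - 2 * pi * r\<bar> \<le> pi * R + 2 * pi * r"
    using assms by (simp add: abs_le_iff)
  also have "\<dots> \<le> (1 + pi * R / L) * (L + 2 * pi * r)"
    using assms by (simp add: field_simps)
  finally show ?thesis
    using pos by (simp add: scaled_score_def abs_divide pos_divide_le_eq)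
qed

text \<open>An exact expansion around \<open>L\<close>: the first term obeys the central limit
  theorem, and the coefficient of \<open>t - L\<close> is close to the sum of squared scores when
  \<open>t\<close> is close to \<open>L\<close>.\<close>

lemma lik_crit_expand:
  assumes "0 < L" "0 < t" "\<And>i. 0 \<le> d i"
  shows "lik_crit R n d t = (L + pi * R) * (\<Sum>i<n. scaled_score R L (d i)) -
    (t - L) * (\<Sum>i<n. (scaled_score R L (d i))\<^sup>2 * ((L + 2 * pi * d i) / (t + 2 * pi * d i)))"
  unfolding lik_crit_def sum_distrib_left sum_subtractf[symmetric]
proof (intro sum.cong refl)
  fix i
  have "0 < L + 2 * pi * d i" "0 < t + 2 * pi * d i"
    using assms(1,2) assms(3)[of i] by (simp_all add: add_pos_nonneg)
  \<comment> \<open>For the values inserted below, \<open>x + u = L + pi * R\<close> and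
    \<open>y - x = t - L\<close>.\<close>
  moreover have "u + u\<^sup>2 / y = (x + u) * (u / x) - (y - x) * ((u / x)\<^sup>2 * (x / y))"
    if "0 < x" "0 < y" for u x y :: real
    using that by (simp add: divide_simps) (simp add: power2_eq_square algebra_simps)
  note this[of "L + 2 * pi * d i" "t + 2 * pi * d i" "pi * R - 2 * pi * d i"]
  ultimately show "pi * R - 2 * pi * d i + (pi * R - 2 * pi * d i)\<^sup>2 / (t + 2 * pi * d i) =
      (L + pi * R) * scaled_score R L (d i) -
      (t - L) * ((scaled_score R L (d i))\<^sup>2 * ((L + 2 * pi * d i) / (t + 2 * pi * d i)))"
    by (simp add: scaled_score_def)
qed

section \<open>Asymptotics of the estimator\<close>

text \<open>Separates the statistics from the geometry of \<open>S\<close>. Nonnegativity is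
  demanded at every sample point, so the facts about the likelihood apply pointwise and not merely
  almost surely.\<close>

locale distance_sample = prob_space M for M :: "'a measure" +
  fixes R L :: real and D :: "nat \<Rightarrow> 'a \<Rightarrow> real"
  assumes R_pos: "0 < R" and L_pos: "0 < L"
    and D_distributed: "\<And>i. distributed M lborel (D i) (\<lambda>r. ennreal (dist_density R L r))"
    and D_nonneg: "\<And>i \<omega>. \<omega> \<in> space M \<Longrightarrow> 0 \<le> D i \<omega>"
    and D_indep: "indep_vars (\<lambda>_. borel) D UNIV"
begin

lemma D_measurable [measurable]: "D i \<in> borel_measurable M"
  using distributed_measurable[OF D_distributed] by simp

lemma lik_crit_measurable [measurable]:
  "(\<lambda>\<omega>. lik_crit R n (\<lambda>i. D i \<omega>) t) \<in> borel_measurable M"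
  unfolding lik_crit_def by measurable

lemma expectation_D:
  "g \<in> borel_measurable borel \<Longrightarrow> expectation (\<lambda>\<omega>. g (D i \<omega>)) = (\<integral>r. dist_density R L r * g r \<partial>lborel)"
  using distributed_integral[OF D_distributed, of g i] dist_density_nonneg[OF R_pos L_pos] by simp

lemma distr_compose_D:
  assumes [measurable]: "g \<in> borel_measurable borel"
  shows "distr M borel (\<lambda>\<omega>. g (D i \<omega>)) = distr M borel (\<lambda>\<omega>. g (D j \<omega>))"
proof -
  have "distr M borel (\<lambda>\<omega>. g (D i \<omega>)) =
      distr (density lborel (\<lambda>r. ennreal (dist_density R L r))) borel g" for i
    unfolding distributed_distr_eq_density[OF D_distributed[of i], symmetric]
    by (subst distr_distr) (auto simp: comp_def)
  then show ?thesis by simp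
qed

lemma indep_compose_D:
  "g \<in> borel_measurable borel \<Longrightarrow> indep_vars (\<lambda>_. borel) (\<lambda>i \<omega>. g (D i \<omega>)) UNIV"
  by (rule indep_vars_compose2[OF D_indep])

lemma weak_law_D:
  assumes g [measurable]: "g \<in> borel_measurable borel"
    and bound: "\<And>r. 0 \<le> r \<Longrightarrow> \<bar>g r\<bar> \<le> b" and "0 < \<epsilon>"
  shows "(\<lambda>n. prob {\<omega> \<in> space M.
    \<epsilon> \<le> \<bar>(\<Sum>i<n. g (D i \<omega>)) / real n - (\<integral>r. dist_density R L r * g r \<partial>lborel)\<bar>}) \<longlonglongrightarrow> 0"
  using weak_law_of_large_numbers_bounded[of "\<lambda>i \<omega>. g (D i \<omega>)" b \<epsilon>] indep_compose_D[OF g]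
    distr_compose_D[OF g, of _ 0] bound D_nonneg \<open>0 < \<epsilon>\<close> expectation_D[OF g, of 0]
  by simp

abbreviation "W i \<omega> \<equiv> scaled_score R L (D i \<omega>)"

lemma weak_law_W:
  "0 < \<epsilon> \<Longrightarrow> (\<lambda>n. prob {\<omega> \<in> space M. \<epsilon> \<le> \<bar>(\<Sum>i<n. W i \<omega>) / real n\<bar>}) \<longlonglongrightarrow> 0"
  using weak_law_D[of "scaled_score R L" "1 + pi * R / L" \<epsilon>] abs_scaled_score_le[OF R_pos L_pos]
    integral_scaled_score[OF R_pos L_pos] by simp

lemma W_sq_le: "\<omega> \<in> space M \<Longrightarrow> (W i \<omega>)\<^sup>2 \<le> (1 + pi * R / L)\<^sup>2"
  using power_mono[OF abs_scaled_score_le[OF R_pos L_pos D_nonneg] abs_ge_zero, of \<omega> i 2] by simp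

lemma weak_law_W_sq:
  "0 < \<epsilon> \<Longrightarrow> (\<lambda>n. prob {\<omega> \<in> space M. \<epsilon> \<le> \<bar>(\<Sum>i<n. (W i \<omega>)\<^sup>2) / real n - scaled_info R L\<bar>}) \<longlonglongrightarrow> 0"
  using weak_law_D[of "\<lambda>r. (scaled_score R L r)\<^sup>2" "(1 + pi * R / L)\<^sup>2" \<epsilon>]
    power_mono[OF abs_scaled_score_le[OF R_pos L_pos] abs_ge_zero, of _ 2]
    integral_scaled_score_sq[OF R_pos L_pos] by simp

text \<open>The scaled scores are i.i.d., centred and bounded, with positive variance. Since the
  normal distribution function is continuous, weak convergence gives convergence at every
  \<open>x\<close>.\<close>

lemma clt_W:
  "(\<lambda>n. prob {\<omega> \<in> space M. (\<Sum>i<n. W i \<omega>) / sqrt (real n * scaled_info R L) \<le> x})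
    \<longlonglongrightarrow> cdf std_normal_distribution x"
proof -
  let ?\<sigma> = "sqrt (scaled_info R L)"
  have v: "0 < scaled_info R L" by (rule scaled_info_pos[OF R_pos L_pos])
  have mean: "expectation (W i) = 0" for i
    using expectation_D[of "scaled_score R L" i] integral_scaled_score[OF R_pos L_pos] by simp
  have sq: "expectation (\<lambda>\<omega>. (W i \<omega>)\<^sup>2) = scaled_info R L" for i
    using expectation_D[of "\<lambda>r. (scaled_score R L r)\<^sup>2" i] integral_scaled_score_sq[OF R_pos L_pos] by simp
  have "weak_conv_m (\<lambda>n. distr M borel (\<lambda>\<omega>. (\<Sum>i<n. W i \<omega>) / sqrt (real n * ?\<sigma>\<^sup>2))) std_normal_distribution"
  proof (rule central_limit_theorem_zero_mean)
    show "indep_vars (\<lambda>_. borel) W UNIV"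
      by (rule indep_compose_D) simp
    show "expectation (W n) = 0" for n by (rule mean)
    show "0 < ?\<sigma>" using v by simp
    show "integrable M (\<lambda>\<omega>. (W n \<omega>)\<^sup>2)" for n
      using W_sq_le by (intro integrable_const_bound[where B = "(1 + pi * R / L)\<^sup>2"] AE_I2) auto
    show "variance (W n) = ?\<sigma>\<^sup>2" for n
      using v by (simp add: mean sq)
    show "distr M borel (W n) = distr M borel (W 0)" for n
      by (rule distr_compose_D) simp
  qed
  then have "(\<lambda>n. cdf (distr M borel (\<lambda>\<omega>. (\<Sum>i<n. W i \<omega>) / sqrt (real n * ?\<sigma>\<^sup>2))) x)
      \<longlonglongrightarrow> cdf std_normal_distribution x"
    using isCont_cdf_std_normal by (simp add: weak_conv_m_def weak_conv_def)
  moreover have "cdf (distr M borel (\<lambda>\<omega>. (\<Sum>i<n. W i \<omega>) / sqrt (real n * ?\<sigma>\<^sup>2))) x =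
      prob {\<omega> \<in> space M. (\<Sum>i<n. W i \<omega>) / sqrt (real n * scaled_info R L) \<le> x}" for n
    using v by (simp add: cdf_def measure_distr vimage_def Int_def conj_commute)
  ultimately show ?thesis by simp
qed

section \<open>Sign change of \<open>lik_crit\<close> and existence of the estimator\<close>

text \<open>By the weak laws the score sum is small and the sum of squared scores is of order
  \<open>n\<close>, so at the fixed points \<open>L / 2\<close> and \<open>2 * L\<close> the linear
  term of the expansion determines the sign.\<close>

lemma prob_no_sign_change_tendsto_0:
  "(\<lambda>n. prob {\<omega> \<in> space M. \<not> (0 < lik_crit R n (\<lambda>i. D i \<omega>) (L / 2) \<and> lik_crit R n (\<lambda>i. D i \<omega>) (2 * L) < 0)}) \<longlonglongrightarrow> 0"
  (is "(\<lambda>n. prob (?Bad n)) \<longlonglongrightarrow> 0")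
proof -
  let ?v = "scaled_info R L"
  \<comment> \<open>Chosen so that the score term stays below \<open>n * L * ?v / 4\<close>, which
    the linear term exceeds at both points.\<close>
  define \<epsilon> where "\<epsilon> = L * ?v / (4 * (L + pi * R))"
  have v: "0 < ?v" by (rule scaled_info_pos[OF R_pos L_pos])
  have posR: "0 < L + pi * R"
    using R_pos L_pos by (simp add: add_pos_pos)
  have \<epsilon>: "0 < \<epsilon>" "(L + pi * R) * \<epsilon> = L * ?v / 4"
  proof -
    have "A * (x / (4 * A)) = x / 4" if "0 < A" for A x :: real
      using that by simp
    from this[OF posR] show "(L + pi * R) * \<epsilon> = L * ?v / 4"
      unfolding \<epsilon>_def .
    show "0 < \<epsilon>"
      unfolding \<epsilon>_def using v posR L_pos by (intro divide_pos_pos mult_pos_pos) auto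
  qed
  let ?E1 = "\<lambda>n. {\<omega> \<in> space M. \<epsilon> \<le> \<bar>(\<Sum>i<n. W i \<omega>) / real n\<bar>}"
  let ?E2 = "\<lambda>n. {\<omega> \<in> space M. ?v / 2 \<le> \<bar>(\<Sum>i<n. (W i \<omega>)\<^sup>2) / real n - ?v\<bar>}"
  have sub: "?Bad n \<subseteq> ?E1 n \<union> ?E2 n" if n: "0 < n" for n
  proof
    fix \<omega> assume \<omega>: "\<omega> \<in> ?Bad n"
    show "\<omega> \<in> ?E1 n \<union> ?E2 n"
    proof (rule ccontr)
      assume "\<omega> \<notin> ?E1 n \<union> ?E2 n"
      with \<omega> have *: "\<bar>(\<Sum>i<n. W i \<omega>) / real n\<bar> < \<epsilon>" "\<bar>(\<Sum>i<n. (W i \<omega>)\<^sup>2) / real n - ?v\<bar> < ?v / 2"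
        by auto
      let ?s = "\<Sum>i<n. W i \<omega>" and ?q = "\<Sum>i<n. (W i \<omega>)\<^sup>2"
      have nonneg: "0 \<le> D i \<omega>" for i
        using \<omega> by (auto intro: D_nonneg)
      have "\<bar>?s\<bar> < real n * \<epsilon>"
        using *(1) n by (simp add: abs_divide field_simps)
      then have "(L + pi * R) * \<bar>?s\<bar> < (L + pi * R) * (real n * \<epsilon>)"
        using posR by (rule mult_strict_left_mono)
      then have s: "\<bar>(L + pi * R) * ?s\<bar> < real n * (L * ?v / 4)"
      proof -
        have "(L + pi * R) * (real n * \<epsilon>) = real n * (L * ?v / 4)"
          unfolding \<epsilon>(2)[symmetric] by (rule mult.left_commute)
        moreover have "\<bar>(L + pi * R) * ?s\<bar> = (L + pi * R) * \<bar>?s\<bar>"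
          using posR by (simp only: abs_mult abs_of_pos)
        ultimately show ?thesis
          using \<open>(L + pi * R) * \<bar>?s\<bar> < (L + pi * R) * (real n * \<epsilon>)\<close> by (simp only:)
      qed
      have "?v / 2 < ?q / real n"
        using *(2) by linarith
      then have "real n * ?v / 2 < ?q"
        using n by (simp add: field_simps)
      then have q: "real n * (L * ?v / 4) < L / 2 * ?q"
        using L_pos by (simp add: field_simps)
      \<comment> \<open>At \<open>L / 2\<close> the weights are at least \<open>1\<close> and
        \<open>t - L = - L / 2\<close>. At \<open>2 * L\<close> they are at least
        \<open>1 / 2\<close> and \<open>t - L = L\<close>. Both give a linear term of size at least
        \<open>L / 2 * ?q\<close>.\<close>
      have "?q \<le> (\<Sum>i<n. (W i \<omega>)\<^sup>2 * ((L + 2 * pi * D i \<omega>) / (L / 2 + 2 * pi * D i \<omega>)))"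
      proof (rule sum_mono)
        fix i
        have "0 < L / 2 + 2 * pi * D i \<omega>"
          using L_pos nonneg[of i] by (simp add: add_pos_nonneg)
        then have "1 \<le> (L + 2 * pi * D i \<omega>) / (L / 2 + 2 * pi * D i \<omega>)"
          using L_pos by (simp add: le_divide_eq)
        then show "(W i \<omega>)\<^sup>2 \<le> (W i \<omega>)\<^sup>2 * ((L + 2 * pi * D i \<omega>) / (L / 2 + 2 * pi * D i \<omega>))"
          using mult_left_mono[of 1 _ "(W i \<omega>)\<^sup>2"] by (metis mult_1_right zero_le_power2)
      qed
      then have "(L + pi * R) * ?s + L / 2 * ?q \<le> lik_crit R n (\<lambda>i. D i \<omega>) (L / 2)"
        using L_pos nonneg by (subst lik_crit_expand[of L]) auto
      then have low: "0 < lik_crit R n (\<lambda>i. D i \<omega>) (L / 2)"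
        using s q by linarith
      have "1 / 2 * ?q \<le> (\<Sum>i<n. (W i \<omega>)\<^sup>2 * ((L + 2 * pi * D i \<omega>) / (2 * L + 2 * pi * D i \<omega>)))"
        unfolding sum_distrib_left
      proof (rule sum_mono)
        fix i
        have "0 < 2 * L + 2 * pi * D i \<omega>"
          using L_pos nonneg[of i] by (simp add: add_pos_nonneg)
        then have "1 / 2 \<le> (L + 2 * pi * D i \<omega>) / (2 * L + 2 * pi * D i \<omega>)"
          using L_pos nonneg[of i] by (simp add: le_divide_eq)
        then show "1 / 2 * (W i \<omega>)\<^sup>2 \<le> (W i \<omega>)\<^sup>2 * ((L + 2 * pi * D i \<omega>) / (2 * L + 2 * pi * D i \<omega>))"
          using mult_left_mono[of "1 / 2" _ "(W i \<omega>)\<^sup>2"] by (metis mult.commute zero_le_power2)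
      qed
      then have "L * (1 / 2 * ?q) \<le> L * (\<Sum>i<n. (W i \<omega>)\<^sup>2 * ((L + 2 * pi * D i \<omega>) / (2 * L + 2 * pi * D i \<omega>)))"
        using L_pos by (intro mult_left_mono) auto
      then have "lik_crit R n (\<lambda>i. D i \<omega>) (2 * L) \<le> (L + pi * R) * ?s - L / 2 * ?q"
        using L_pos nonneg by (subst lik_crit_expand[of L]) auto
      then have "lik_crit R n (\<lambda>i. D i \<omega>) (2 * L) < 0"
        using s q by linarith
      with low \<omega> show False by auto
    qed
  qed
  show ?thesis
  proof (rule tendsto_sandwich[where f = "\<lambda>_. 0" and h = "\<lambda>n. prob (?E1 n) + prob (?E2 n)"])
    show "\<forall>\<^sub>F n in sequentially. prob (?Bad n) \<le> prob (?E1 n) + prob (?E2 n)"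
      using eventually_gt_at_top[of 0]
    proof eventually_elim
      fix n :: nat assume "0 < n"
      have "prob (?Bad n) \<le> prob (?E1 n \<union> ?E2 n)"
        by (intro finite_measure_mono sub[OF \<open>0 < n\<close>]) measurable
      also have "\<dots> \<le> prob (?E1 n) + prob (?E2 n)"
        by (intro measure_Un_le) measurable
      finally show "prob (?Bad n) \<le> prob (?E1 n) + prob (?E2 n)" .
    qed
    show "(\<lambda>n. prob (?E1 n) + prob (?E2 n)) \<longlonglongrightarrow> 0"
      using tendsto_add[OF weak_law_W[OF \<epsilon>(1)] weak_law_W_sq[of "?v / 2"]] v by simp
  qed auto
qed

lemma prob_ex1_mle_tendsto_1:
  "(\<lambda>n. prob {\<omega> \<in> space M. \<exists>!L. is_mle R n (\<lambda>i. D i \<omega>) L}) \<longlonglongrightarrow> 1"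
proof (rule tendsto_sandwich)
  let ?E = "\<lambda>n. {\<omega> \<in> space M. \<exists>!L. is_mle R n (\<lambda>i. D i \<omega>) L}"
  let ?Bad = "\<lambda>n. {\<omega> \<in> space M. \<not> (0 < lik_crit R n (\<lambda>i. D i \<omega>) (L / 2) \<and> lik_crit R n (\<lambda>i. D i \<omega>) (2 * L) < 0)}"
  \<comment> \<open>Gives measurability of the event, without which monotonicity of the measure
    could not be applied.\<close>
  have E_eq: "?E n = {\<omega> \<in> space M. \<exists>p q :: rat. 0 < p \<and> p \<le> q \<and>
      0 < lik_crit R n (\<lambda>i. D i \<omega>) (of_rat p) \<and> lik_crit R n (\<lambda>i. D i \<omega>) (of_rat q) < 0}" for n
  proof (intro Collect_cong conj_cong refl)
    fix \<omega> assume "\<omega> \<in> space M"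
    then show "(\<exists>!L. is_mle R n (\<lambda>i. D i \<omega>) L) \<longleftrightarrow> (\<exists>p q :: rat. 0 < p \<and> p \<le> q \<and>
        0 < lik_crit R n (\<lambda>i. D i \<omega>) (of_rat p) \<and> lik_crit R n (\<lambda>i. D i \<omega>) (of_rat q) < 0)"
      by (intro ex1_mle_iff R_pos D_nonneg)
  qed
  have [measurable]: "?E n \<in> events" for n
    unfolding E_eq by measurable
  show "\<forall>\<^sub>F n in sequentially. 1 - prob (?Bad n) \<le> prob (?E n)"
  proof (rule always_eventually, rule allI)
    fix n
    have "\<exists>!L. is_mle R n (\<lambda>i. D i \<omega>) L" if "\<omega> \<in> space M" "\<omega> \<notin> ?Bad n" for \<omega>
      using that L_pos by (intro ex1_mle[OF R_pos, of "L / 2" "2 * L"] D_nonneg[OF that(1)]) auto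
    then have "space M - ?Bad n \<subseteq> ?E n"
      by blast
    then have "prob (space M - ?Bad n) \<le> prob (?E n)"
      by (intro finite_measure_mono) measurable
    moreover have "prob (space M - ?Bad n) = 1 - prob (?Bad n)"
      by (intro prob_compl) measurable
    ultimately show "1 - prob (?Bad n) \<le> prob (?E n)" by simp
  qed
  show "(\<lambda>n. 1 - prob (?Bad n)) \<longlonglongrightarrow> 1"
    using tendsto_diff[OF tendsto_const prob_no_sign_change_tendsto_0, of 1] by simp
qed auto

lemma ml_estimator_mle_fun:
  "ml_estimator M R n D (\<lambda>\<omega>. mle_fun R n (\<lambda>i. D i \<omega>))"
proof -
  have [measurable]: "(\<lambda>\<omega>. lik_root R n (\<lambda>i. D i \<omega>)) \<in> borel_measurable M"
    unfolding lik_root_def by measurable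
  have "(\<lambda>\<omega>. mle_fun R n (\<lambda>i. D i \<omega>)) \<in> borel_measurable M"
    unfolding mle_fun_def by measurable
  moreover have "is_mle R n (\<lambda>i. D i \<omega>) (mle_fun R n (\<lambda>i. D i \<omega>))"
    if "\<omega> \<in> space M" "is_mle R n (\<lambda>i. D i \<omega>) L'" for \<omega> L'
    using that(2) by (intro is_mle_mle_fun R_pos D_nonneg[OF that(1)])
  ultimately show ?thesis
    by (auto simp: ml_estimator_def)
qed

section \<open>Limit law of the estimator\<close>

text \<open>Dividing the expansion at \<open>L + x / sqrt n\<close> by
  \<open>(L + pi * R) * sqrt (n * ?v)\<close> rewrites the event as: normalised score sum at most
  \<open>Z n\<close>, where \<open>Z n\<close> tends to \<open>k * ?v\<close> in
  probability.\<close>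

lemma prob_crit_le_0_tendsto:
  "(\<lambda>n. prob {\<omega> \<in> space M. lik_crit R n (\<lambda>i. D i \<omega>) (L + x / sqrt (real n)) \<le> 0})
    \<longlonglongrightarrow> cdf std_normal_distribution (x / sqrt (asymp_var R L))"
proof -
  let ?v = "scaled_info R L"
  let ?A = "L + pi * R"
  let ?t = "\<lambda>n. L + x / sqrt (real n)"
  let ?K = "(1 + pi * R / L)\<^sup>2"
  define k where "k = x / (sqrt ?v * ?A)"
  define Z where "Z n \<omega> = k * ((\<Sum>i<n. (W i \<omega>)\<^sup>2 * ((L + 2 * pi * D i \<omega>) / (?t n + 2 * pi * D i \<omega>))) / real n)" for n \<omega>
  have v: "0 < ?v" by (rule scaled_info_pos[OF R_pos L_pos])
  have A: "0 < ?A"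
    using R_pos L_pos by (simp add: add_pos_pos)
  have kv: "k * ?v = x / sqrt (asymp_var R L)"
  proof -
    have "sqrt (asymp_var R L) = ?A / sqrt ?v"
      using A by (simp add: asymp_var_eq[OF R_pos L_pos] real_sqrt_divide)
    moreover have "x / (s * a) * (s * s) = x / (a / s)" if "0 < s" "0 < a" for s a
      using that by simp
    from this[of "sqrt ?v" ?A] have "k * ?v = x / (?A / sqrt ?v)"
      using v A by (simp add: k_def)
    ultimately show ?thesis by simp
  qed
  have t_pos: "\<forall>\<^sub>F n in sequentially. 0 < ?t n"
    using order_tendstoD(1)[OF tendsto_add_divide_sqrt L_pos] .
  \<comment> \<open>The weights differ from \<open>1\<close> by at most
    \<open>\<bar>L - t\<bar> / t\<close>, uniformly over the sample, so the weighted mean of squared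
    scores has the same limit as the unweighted one.\<close>
  have Z_lim: "(\<lambda>n. prob {\<omega> \<in> space M. \<epsilon> \<le> \<bar>Z n \<omega> - k * ?v\<bar>}) \<longlonglongrightarrow> 0" if \<epsilon>: "0 < \<epsilon>" for \<epsilon>
  proof -
    \<comment> \<open>Two errors of size \<open>\<delta>\<close> are multiplied by
      \<open>\<bar>k\<bar>\<close>; the \<open>+ 1\<close> covers \<open>k = 0\<close>.\<close>
    define \<delta> where "\<delta> = \<epsilon> / (2 * (\<bar>k\<bar> + 1))"
    have \<delta>: "0 < \<delta>" "\<bar>k\<bar> * (2 * \<delta>) < \<epsilon>"
      using \<epsilon> by (simp_all add: \<delta>_def divide_less_eq algebra_simps)
    let ?E = "\<lambda>n. {\<omega> \<in> space M. \<delta> \<le> \<bar>(\<Sum>i<n. (W i \<omega>)\<^sup>2) / real n - ?v\<bar>}"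
    have "(\<lambda>n. ?K * (\<bar>L - ?t n\<bar> / ?t n)) \<longlonglongrightarrow> ?K * (\<bar>L - L\<bar> / L)"
      using L_pos by (intro tendsto_intros tendsto_add_divide_sqrt) auto
    then have small: "\<forall>\<^sub>F n in sequentially. ?K * (\<bar>L - ?t n\<bar> / ?t n) < \<delta>"
      using \<delta>(1) by (auto dest: order_tendstoD(2))
    show ?thesis
    proof (rule tendsto_sandwich[where f = "\<lambda>_. 0" and h = "\<lambda>n. prob (?E n)"])
      show "\<forall>\<^sub>F n in sequentially. prob {\<omega> \<in> space M. \<epsilon> \<le> \<bar>Z n \<omega> - k * ?v\<bar>} \<le> prob (?E n)"
        using small t_pos eventually_gt_at_top[of 0]
      proof eventually_elim
        fix n :: nat
        assume sm: "?K * (\<bar>L - ?t n\<bar> / ?t n) < \<delta>" and tp: "0 < ?t n" and n: "0 < n"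
        have "\<omega> \<in> ?E n" if \<omega>: "\<omega> \<in> space M" "\<epsilon> \<le> \<bar>Z n \<omega> - k * ?v\<bar>" for \<omega>
        proof (rule ccontr)
          assume "\<omega> \<notin> ?E n"
          with \<omega>(1) have q: "\<bar>(\<Sum>i<n. (W i \<omega>)\<^sup>2) / real n - ?v\<bar> < \<delta>" by auto
          let ?r = "\<lambda>i. (L + 2 * pi * D i \<omega>) / (?t n + 2 * pi * D i \<omega>)"
          have "\<bar>(\<Sum>i<n. (W i \<omega>)\<^sup>2 * ?r i) - (\<Sum>i<n. (W i \<omega>)\<^sup>2)\<bar> =
              \<bar>\<Sum>i<n. (W i \<omega>)\<^sup>2 * (?r i - 1)\<bar>"
            by (simp add: sum_subtractf right_diff_distrib)
          also have "\<dots> \<le> (\<Sum>i<n. \<bar>(W i \<omega>)\<^sup>2 * (?r i - 1)\<bar>)"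
            by (rule sum_abs)
          also have "\<dots> \<le> (\<Sum>i<n. ?K * (\<bar>L - ?t n\<bar> / ?t n))"
          proof (rule sum_mono)
            fix i
            have d: "0 \<le> 2 * pi * D i \<omega>"
              using D_nonneg[OF \<omega>(1)] by simp
            then have p: "0 < ?t n + 2 * pi * D i \<omega>"
              using tp by linarith
            then have "?r i - 1 = (L - ?t n) / (?t n + 2 * pi * D i \<omega>)"
              by (simp add: diff_divide_eq_iff field_simps)
            then have "\<bar>?r i - 1\<bar> = \<bar>L - ?t n\<bar> / (?t n + 2 * pi * D i \<omega>)"
              using p by (simp add: abs_divide)
            also have "\<dots> \<le> \<bar>L - ?t n\<bar> / ?t n"
              using tp d p by (intro divide_left_mono mult_pos_pos) auto
            finally show "\<bar>(W i \<omega>)\<^sup>2 * (?r i - 1)\<bar> \<le> ?K * (\<bar>L - ?t n\<bar> / ?t n)"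
              unfolding abs_mult using W_sq_le[OF \<omega>(1)] tp by (intro mult_mono) auto
          qed
          also have "\<dots> = real n * (?K * (\<bar>L - ?t n\<bar> / ?t n))"
            by simp
          also have "\<dots> < real n * \<delta>"
            using sm n by (intro mult_strict_left_mono) auto
          finally have "\<bar>(\<Sum>i<n. (W i \<omega>)\<^sup>2 * ?r i) - (\<Sum>i<n. (W i \<omega>)\<^sup>2)\<bar> / real n < \<delta>"
            using n by (simp add: divide_less_eq mult.commute)
          then have "\<bar>(\<Sum>i<n. (W i \<omega>)\<^sup>2 * ?r i) / real n - (\<Sum>i<n. (W i \<omega>)\<^sup>2) / real n\<bar> < \<delta>"
            by (simp add: diff_divide_distrib[symmetric] abs_divide)
          with q have "\<bar>(\<Sum>i<n. (W i \<omega>)\<^sup>2 * ?r i) / real n - ?v\<bar> \<le> 2 * \<delta>"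
            by linarith
          then have "\<bar>k\<bar> * \<bar>(\<Sum>i<n. (W i \<omega>)\<^sup>2 * ?r i) / real n - ?v\<bar> \<le> \<bar>k\<bar> * (2 * \<delta>)"
            by (intro mult_left_mono) auto
          then have "\<bar>Z n \<omega> - k * ?v\<bar> \<le> \<bar>k\<bar> * (2 * \<delta>)"
            unfolding Z_def right_diff_distrib[symmetric] abs_mult .
          with \<delta>(2) \<omega>(2) show False by linarith
        qed
        then show "prob {\<omega> \<in> space M. \<epsilon> \<le> \<bar>Z n \<omega> - k * ?v\<bar>} \<le> prob (?E n)"
          by (intro finite_measure_mono) auto
      qed
      show "(\<lambda>n. prob (?E n)) \<longlonglongrightarrow> 0"
        by (rule weak_law_W_sq[OF \<delta>(1)])
    qed auto
  qed
  have [measurable]: "Z n \<in> borel_measurable M" for n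
    unfolding Z_def[abs_def] by measurable
  have lim: "(\<lambda>n. prob {\<omega> \<in> space M. (\<Sum>i<n. W i \<omega>) / sqrt (real n * ?v) \<le> Z n \<omega>})
      \<longlonglongrightarrow> cdf std_normal_distribution (k * ?v)"
    by (rule prob_le_tendsto_cdf[OF _ _ clt_W Z_lim isCont_cdf_std_normal]) measurable
  have "\<forall>\<^sub>F n in sequentially.
      prob {\<omega> \<in> space M. (\<Sum>i<n. W i \<omega>) / sqrt (real n * ?v) \<le> Z n \<omega>} =
      prob {\<omega> \<in> space M. lik_crit R n (\<lambda>i. D i \<omega>) (?t n) \<le> 0}"
    using t_pos eventually_gt_at_top[of 0]
  proof eventually_elim
    fix n :: nat assume tp: "0 < ?t n" and n: "0 < n"
    have "lik_crit R n (\<lambda>i. D i \<omega>) (?t n) \<le> 0 \<longleftrightarrow> (\<Sum>i<n. W i \<omega>) / sqrt (real n * ?v) \<le> Z n \<omega>"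
      if \<omega>: "\<omega> \<in> space M" for \<omega>
    proof -
      let ?s = "\<Sum>i<n. W i \<omega>"
      let ?q = "\<Sum>i<n. (W i \<omega>)\<^sup>2 * ((L + 2 * pi * D i \<omega>) / (?t n + 2 * pi * D i \<omega>))"
      let ?c = "?A * sqrt (real n * ?v)"
      have c: "0 < ?c"
        using A v n by simp
      have "?c * (?s / sqrt (real n * ?v)) = ?A * ?s"
        using v n by simp
      moreover have "?c * Z n \<omega> = (?t n - L) * ?q"
      proof -
        have "a * (m * s) * (x / (s * a) * (q / (m * m))) = x / m * q"
          if "0 < a" "0 < m" "0 < s" for a m s q :: real
          using that by (simp add: field_simps)
        from this[OF A, of "sqrt (real n)" "sqrt ?v" ?q] show ?thesis
          using n v by (simp add: Z_def k_def real_sqrt_mult)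
      qed
      ultimately have "lik_crit R n (\<lambda>i. D i \<omega>) (?t n) = ?c * (?s / sqrt (real n * ?v)) - ?c * Z n \<omega>"
        by (simp only: lik_crit_expand[OF L_pos tp D_nonneg[OF \<omega>]])
      then show ?thesis
        using c by (simp add: mult_le_cancel_left_pos del: times_divide_eq_right)
    qed
    then have "{\<omega> \<in> space M. (\<Sum>i<n. W i \<omega>) / sqrt (real n * ?v) \<le> Z n \<omega>} =
        {\<omega> \<in> space M. lik_crit R n (\<lambda>i. D i \<omega>) (?t n) \<le> 0}"
      by auto
    then show "prob {\<omega> \<in> space M. (\<Sum>i<n. W i \<omega>) / sqrt (real n * ?v) \<le> Z n \<omega>} =
        prob {\<omega> \<in> space M. lik_crit R n (\<lambda>i. D i \<omega>) (?t n) \<le> 0}"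
      by simp
  qed
  with lim show ?thesis
    unfolding kv by (rule Lim_transform_eventually)
qed

text \<open>The values of \<open>Lhat n\<close> on samples without a maximiser are arbitrary, but
  such samples lie in \<open>?Bad n\<close>. Outside it the two events coincide for large
  \<open>n\<close>, so their probabilities differ by at most that of \<open>?Bad n\<close>.\<close>

lemma ml_estimator_asymptotically_normal:
  assumes "\<And>n. ml_estimator M R n D (Lhat n)"
  shows "weak_conv_m (\<lambda>n. distr M borel (\<lambda>\<omega>. sqrt (real n) * (Lhat n \<omega> - L)))
    (density lborel (\<lambda>x. ennreal (normal_density 0 (sqrt (asymp_var R L)) x)))"
  unfolding weak_conv_m_def weak_conv_def
proof (intro allI impI)
  fix x
  have [measurable]: "Lhat n \<in> borel_measurable M" for n
    using assms by (simp add: ml_estimator_def)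
  let ?t = "\<lambda>n. L + x / sqrt (real n)"
  let ?P = "\<lambda>n. {\<omega> \<in> space M. sqrt (real n) * (Lhat n \<omega> - L) \<le> x}"
  let ?Q = "\<lambda>n. {\<omega> \<in> space M. lik_crit R n (\<lambda>i. D i \<omega>) (?t n) \<le> 0}"
  let ?Bad = "\<lambda>n. {\<omega> \<in> space M. \<not> (0 < lik_crit R n (\<lambda>i. D i \<omega>) (L / 2) \<and> lik_crit R n (\<lambda>i. D i \<omega>) (2 * L) < 0)}"
  have iff: "sqrt (real n) * (Lhat n \<omega> - L) \<le> x \<longleftrightarrow> lik_crit R n (\<lambda>i. D i \<omega>) (?t n) \<le> 0"
    if "0 < ?t n" "0 < n" "\<omega> \<in> space M" "\<omega> \<notin> ?Bad n" for n \<omega>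
  proof -
    have pos: "0 < lik_crit R n (\<lambda>i. D i \<omega>) (L / 2)" and neg: "lik_crit R n (\<lambda>i. D i \<omega>) (2 * L) < 0"
      using that by auto
    have "\<exists>!L'. is_mle R n (\<lambda>i. D i \<omega>) L'"
      using L_pos by (intro ex1_mle[OF R_pos _ _ _ pos neg] D_nonneg[OF that(3)]) auto
    then have "is_mle R n (\<lambda>i. D i \<omega>) (Lhat n \<omega>)"
      using assms[of n] that(3) by (auto simp: ml_estimator_def)
    then have "0 < Lhat n \<omega>" "lik_crit R n (\<lambda>i. D i \<omega>) (Lhat n \<omega>) = 0"
      by (auto simp: is_mle_iff_crit_eq_0[OF R_pos D_nonneg[OF that(3)]])
    then have "0 < lik_crit R n (\<lambda>i. D i \<omega>) (?t n) \<longleftrightarrow> ?t n < Lhat n \<omega>"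
      using pos by (intro lik_crit_gt_0_iff[OF that(1) _ D_nonneg[OF that(3)], where u = "L / 2"]) auto
    moreover have "sqrt (real n) * (Lhat n \<omega> - L) \<le> x \<longleftrightarrow> Lhat n \<omega> \<le> ?t n"
      using that(2) by (simp add: field_simps)
    ultimately show ?thesis by linarith
  qed
  have diff: "\<forall>\<^sub>F n in sequentially. norm (prob (?P n) - prob (?Q n)) \<le> prob (?Bad n)"
    using order_tendstoD(1)[OF tendsto_add_divide_sqrt L_pos] eventually_gt_at_top[of 0]
  proof eventually_elim
    fix n :: nat assume tn: "0 < ?t n" "0 < n"
    have "prob (?P n) \<le> prob (?Q n \<union> ?Bad n)" "prob (?Q n) \<le> prob (?P n \<union> ?Bad n)"
      using iff[OF tn] by (auto intro!: finite_measure_mono)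
    moreover have "prob (?Q n \<union> ?Bad n) \<le> prob (?Q n) + prob (?Bad n)"
      "prob (?P n \<union> ?Bad n) \<le> prob (?P n) + prob (?Bad n)"
      by (intro measure_Un_le; measurable)+
    ultimately show "norm (prob (?P n) - prob (?Q n)) \<le> prob (?Bad n)"
      unfolding real_norm_def by linarith
  qed
  have "(\<lambda>n. prob (?P n) - prob (?Q n)) \<longlonglongrightarrow> 0"
    by (rule Lim_null_comparison[OF diff prob_no_sign_change_tendsto_0])
  from tendsto_add[OF this prob_crit_le_0_tendsto[of x]]
  have "(\<lambda>n. prob (?P n)) \<longlonglongrightarrow> cdf std_normal_distribution (x / sqrt (asymp_var R L))"
    by simp
  moreover have "cdf (distr M borel (\<lambda>\<omega>. sqrt (real n) * (Lhat n \<omega> - L))) x = prob (?P n)" for n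
    by (simp add: cdf_def measure_distr vimage_def Int_def conj_commute)
  moreover have \<tau>: "0 < sqrt (asymp_var R L)"
    using scaled_info_pos[OF R_pos L_pos] R_pos L_pos
    by (simp add: asymp_var_eq zero_less_divide_iff add_pos_pos less_imp_neq[symmetric])
  ultimately show "(\<lambda>n. cdf (distr M borel (\<lambda>\<omega>. sqrt (real n) * (Lhat n \<omega> - L))) x)
      \<longlonglongrightarrow> cdf (density lborel (\<lambda>x. ennreal (normal_density 0 (sqrt (asymp_var R L)) x))) x"
    by (simp only: cdf_normal_scale[OF \<tau>])
qed

end

theorem theorem2:
  fixes M :: "'a measure"
    and S :: "(real^2) set"
    and R L0 :: real
    and X :: "nat \<Rightarrow> 'a \<Rightarrow> real^2"
    and D :: "nat \<Rightarrow> 'a \<Rightarrow> real"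
  assumes "prob_space M"
    and "R > 0"
    and "L0 > 0"
    and "compact S"
    and "\<And>r. 0 \<le> r \<Longrightarrow> r < R \<Longrightarrow> volume_fun S r = measure lborel S + L0 * r + pi * r\<^sup>2"
    and "\<And>i. X i \<in> borel_measurable M"
    and "\<And>i. distr M lborel (X i) = uniform_measure lborel (parallel_set S R - S)"
    and "D = (\<lambda>i \<omega>. infdist (X i \<omega>) S)"
    and "prob_space.indep_vars M (\<lambda>_. borel) D UNIV"
  shows "(\<forall>i. distributed M lborel (D i) (\<lambda>r. ennreal (dist_density R L0 r)))
    \<and> (\<forall>n\<ge>1. \<forall>\<omega>\<in>space M. \<forall>L. is_mle R n (\<lambda>i. D i \<omega>) L \<longleftrightarrow>
          L > 0 \<and> 1 / real n * (\<Sum>i<n. 1 / (L + 2 * pi * D i \<omega>)) = 1 / (L + pi * R))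
    \<and> (\<lambda>n. measure M {\<omega> \<in> space M. \<exists>!L. is_mle R n (\<lambda>i. D i \<omega>) L}) \<longlonglongrightarrow> 1
    \<and> (\<exists>Lhat. \<forall>n. ml_estimator M R n D (Lhat n))
    \<and> (\<forall>Lhat. (\<forall>n. ml_estimator M R n D (Lhat n)) \<longrightarrow>
          weak_conv_m (\<lambda>n. distr M borel (\<lambda>\<omega>. sqrt (real n) * (Lhat n \<omega> - L0)))
            (density lborel (\<lambda>x. ennreal (normal_density 0 (sqrt (asymp_var R L0)) x))))
    \<and> asymp_var R L0 = inverse (fisher_information (dist_density R) L0)"
proof -
  \<comment> \<open>The geometry of \<open>S\<close> enters only through the law and the
    nonnegativity of the distances.\<close>
  have dist: "distributed M lborel (D i) (\<lambda>r. ennreal (dist_density R L0 r))" for i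
    unfolding assms(8) by (rule distributed_infdist_uniform[OF assms(1-5) assms(6,7)[of i]])
  have nonneg: "0 \<le> D i \<omega>" for i \<omega>
    by (simp add: assms(8) infdist_nonneg)
  interpret prob_space M by (rule assms(1))
  interpret distance_sample M R L0 D
    by unfold_locales (use assms(2,3,9) dist nonneg in auto)
  show ?thesis
  proof (intro conjI allI ballI impI dist prob_ex1_mle_tendsto_1)
    fix n :: nat and \<omega> L
    assume "1 \<le> n"
    then show "is_mle R n (\<lambda>i. D i \<omega>) L \<longleftrightarrow>
        L > 0 \<and> 1 / real n * (\<Sum>i<n. 1 / (L + 2 * pi * D i \<omega>)) = 1 / (L + pi * R)"
      using lik_crit_eq_0_iff[of L R "\<lambda>i. D i \<omega>" n] assms(2) nonneg
        is_mle_iff_crit_eq_0[of R "\<lambda>i. D i \<omega>" n L]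
      by blast
  next
    show "\<exists>Lhat. \<forall>n. ml_estimator M R n D (Lhat n)"
      using ml_estimator_mle_fun by (intro exI[of _ "\<lambda>n \<omega>. mle_fun R n (\<lambda>i. D i \<omega>)"]) simp
  next
    show "asymp_var R L0 = inverse (fisher_information (dist_density R) L0)"
      by (simp add: asymp_var_eq fisher_information_dist_density assms(2,3))
  next
    fix Lhat
    assume "\<forall>n. ml_estimator M R n D (Lhat n)"
    then show "weak_conv_m (\<lambda>n. distr M borel (\<lambda>\<omega>. sqrt (real n) * (Lhat n \<omega> - L0)))
        (density lborel (\<lambda>x. ennreal (normal_density 0 (sqrt (asymp_var R L0)) x)))"
      by (intro ml_estimator_asymptotically_normal) blast
  qed
qed

end
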